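(* Let $\mathbf{X}$ be a represented space with an ercs $((U_n)_{n\in\mathbb{N}},(B_n)_{n\in\mathbb{N}},R)$, and write $U_m\ll B_k$ for $(m,k)\in R$. Call $p\in\{0,1\}^\mathbb{N}$ consistent if whenever $p(n)=1$, $U_n\ll B_k$ and $B_k\subseteq U_{n_0}\cup\ldots\cup U_{n_\ell}$, then $p(n_i)=1$ for some $i\leq\ell$. Then: (1) The set of consistent $p$ is a $\Pi^0_1$ subset of $\{0,1\}^\mathbb{N}$. (2) If $A\subseteq X$ is a set and $p(n)=1\Leftrightarrow A\cap U_n\neq\emptyset$ for all $n$, then $p$ is consistent. (3) If $p$ is consistent, then $\{U\in\mathcal{O}(\mathbf{X})\mid \exists n,\ell\in\mathbb{N}\ p(n)=1\wedge U_n\ll B_\ell\wedge B_\ell\subseteq U\}$ is the set $\{U \in \mathcal{O}(\mathbf{X})\mid U\cap A\neq\emptyset\}$ for a closed set $A$, which thus is an overt set $A\in\mathcal{V}(\mathbf{X})$ obtained uniformly (computably) from $p$. (4) Moreover, for this $A$, $\mathbf{X}\setminus A=\bigcup_{\{n\mid p(n)=0\}}U_n$.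
   Context: A represented space $\mathbf{X}=(X,\delta_X)$ is a set $X$ with a partial surjection $\delta_X:\subseteq\mathbb{N}^\mathbb{N}\to X$; computability of maps means having computable realizers. $\mathbb{S}=\{\top,\bot\}$ is Sierpiński space ($p$ names $\top$ iff $p$ has a nonzero entry). $\mathcal{O}(\mathbf{X})$: open subsets, identified with characteristic maps $\mathbf{X}\to\mathbb{S}$ under the function-space representation. $\mathcal{K}(\mathbf{X})$: compact subsets $K$ represented by $U\mapsto\top$ iff $K\subseteq U$. $\mathcal{V}(\mathbf{X})$: closed sets $A$ represented by the map $\mathcal{O}(\mathbf{X})\to\mathbb{S}$, $U\mapsto\top$ iff $A\cap U\neq\emptyset$. An effective relatively compact system (ercs) of $\mathbf{X}$ is a triple $((U_n)_{n\in\mathbb{N}},(B_n)_{n\in\mathbb{N}},R)$ where $(U_n)_n$ is a computable sequence in $\mathcal{O}(\mathbf{X})$, $(B_n)_n$ is a computable sequence in $\mathcal{K}(\mathbf{X})$, and $R\subseteq\mathbb{N}\times\mathbb{N}$ is a computably enumerable relation such that $(m,n)\in R$ implies $U_m\subseteq B_n$, and such that for every open $U\in\mathcal{O}(\mathbf{X})$: $U=\bigcup_{\{n\mid U\supseteq B_n\}}\bigcup_{\{m\mid (m,n)\in R\}}U_m$.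
   Formalization: In the definition of consistent, the finite cover of B_k may also be empty, so p(n)=1 is excluded when U_n ≪ B_k with B_k empty; otherwise (3) fails for the constant sequence p=1, since the set of U would then contain the empty set. *)

theory Defs
  imports Main "HOL-Library.FuncSet" "HOL-Library.Nat_Bijection"
begin

section \<open>Computability on Baire space\<close>

type_synonym baire = "nat \<Rightarrow> nat"

text \<open>
  Kleene's schemata relative to an oracle. \<open>partial_recursive k \<Phi>\<close> means that \<open>\<Phi> q xs\<close>, for
  \<open>xs\<close> of length \<open>k\<close>, is the result of one fixed oracle program with oracle \<open>q\<close> on input \<open>xs\<close>;
  \<open>None\<close> is divergence. The values of \<open>\<Phi> q\<close> on lists of any other length carry no meaning.
\<close>

inductive partial_recursive :: "nat \<Rightarrow> (baire \<Rightarrow> nat list \<Rightarrow> nat option) \<Rightarrow> bool" where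
  zero: "partial_recursive k (\<lambda>q xs. Some 0)"
| succ: "partial_recursive 1 (\<lambda>q xs. Some (Suc (hd xs)))"
| proj: "i < k \<Longrightarrow> partial_recursive k (\<lambda>q xs. Some (xs ! i))"
| query: "partial_recursive 1 (\<lambda>q xs. Some (q (hd xs)))"
| subst: "partial_recursive (length \<Gamma>s) \<Phi> \<Longrightarrow> (\<forall>\<Gamma>\<in>set \<Gamma>s. partial_recursive k \<Gamma>) \<Longrightarrow>
    partial_recursive k
      (\<lambda>q xs. Option.bind (those (map (\<lambda>\<Gamma>. \<Gamma> q xs) \<Gamma>s)) (\<Phi> q))"
| prim_rec: "partial_recursive k \<Phi> \<Longrightarrow> partial_recursive (Suc (Suc k)) \<Psi> \<Longrightarrow>
    partial_recursive (Suc k)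
      (\<lambda>q xs. rec_nat (\<Phi> q (tl xs))
        (\<lambda>i r. Option.bind r (\<lambda>v. \<Psi> q (i # v # tl xs))) (hd xs))"
| minimize: "partial_recursive (Suc k) \<Phi> \<Longrightarrow>
    partial_recursive k
      (\<lambda>q xs. if \<exists>i. \<Phi> q (i # xs) = Some 0 \<and> (\<forall>j<i. \<Phi> q (j # xs) \<noteq> None)
              then Some (LEAST i. \<Phi> q (i # xs) = Some 0) else None)"

text \<open>Computable enumerability is taken without oracle, that is, with a constant one.\<close>

definition ce :: "nat \<Rightarrow> nat list set \<Rightarrow> bool" where
  "ce k A \<longleftrightarrow>
    (\<exists>\<Phi>. partial_recursive k \<Phi> \<and> A = {xs. length xs = k \<and> \<Phi> (\<lambda>_. 0) xs \<noteq> None})"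

definition computable :: "(baire \<rightharpoonup> baire) \<Rightarrow> bool" where
  "computable F \<longleftrightarrow>
    (\<exists>\<Phi>. partial_recursive 1 \<Phi> \<and> (\<forall>q r. F q = Some r \<longrightarrow> (\<forall>n. \<Phi> q [n] = Some (r n))))"

section \<open>Represented spaces\<close>

text \<open>
  A represented space is given by its representation \<open>\<delta>\<close>; its underlying set is \<open>ran \<delta>\<close>,
  which makes \<open>\<delta>\<close> a partial surjection.
\<close>

type_synonym 'a represented_space = "baire \<rightharpoonup> 'a"

abbreviation points :: "'a represented_space \<Rightarrow> 'a set" where
  "points X \<equiv> ran X"

definition realizes ::
  "(baire \<rightharpoonup> baire) \<Rightarrow> 'a represented_space \<Rightarrow> 'b represented_space \<Rightarrow> ('a \<Rightarrow> 'b) \<Rightarrow> bool" where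
  "realizes F X Y f \<longleftrightarrow>
    (\<forall>q x. X q = Some x \<longrightarrow> (\<exists>r. F q = Some r \<and> Y r = Some (f x)))"

definition computable_map ::
  "'a represented_space \<Rightarrow> 'b represented_space \<Rightarrow> ('a \<Rightarrow> 'b) \<Rightarrow> bool" where
  "computable_map X Y f \<longleftrightarrow> (\<exists>F. computable F \<and> realizes F X Y f)"

definition nat_space :: "nat represented_space" where
  "nat_space q = Some (q 0)"

definition sierpinski :: "bool represented_space" where
  "sierpinski q = Some (\<exists>n. q n \<noteq> 0)"

text \<open>
  The set \<open>S\<close> with an element \<open>s\<close> named by the names of \<open>e s\<close> in \<open>Z\<close>; the encoding \<open>e\<close> has to be
  injective on \<open>S\<close>.
\<close>

definition induced_space ::
  "'b represented_space \<Rightarrow> ('a \<Rightarrow> 'b) \<Rightarrow> 'a set \<Rightarrow> 'a represented_space" where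
  "induced_space Z e S q =
    (if \<exists>s\<in>S. Z q = Some (e s) then Some (THE s. s \<in> S \<and> Z q = Some (e s)) else None)"

lemma induced_space_eq_Some_iff:
  assumes "inj_on e S"
  shows "induced_space Z e S q = Some s \<longleftrightarrow> s \<in> S \<and> Z q = Some (e s)"
proof -
  have "(THE s. s \<in> S \<and> Z q = Some (e s)) = s" if "s \<in> S" "Z q = Some (e s)" for s
    using that assms by (intro the_equality) (auto dest: inj_onD)
  moreover have "s' = s" if "s \<in> S" "Z q = Some (e s)" "s' \<in> S" "Z q = Some (e s')" for s s'
    using that assms by (auto dest: inj_onD)
  ultimately show ?thesis
    unfolding induced_space_def by (smt (verit) option.inject option.distinct(1))
qed

section \<open>Function spaces\<close>

text \<open>
  Continuous partial functions on Baire space are named by Kleene associates: the value at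
  argument \<open>i\<close> of the function with associate \<open>\<alpha>\<close> on input \<open>q\<close> is \<open>v\<close> iff the first nonzero value
  of \<open>\<alpha>\<close> on the codes of the words \<open>i # [q 0, \<dots>, q (n - 1)]\<close>, for \<open>n = 0, 1, \<dots>\<close>, is \<open>Suc v\<close>.
\<close>

definition associate_value :: "baire \<Rightarrow> baire \<Rightarrow> nat \<Rightarrow> nat option" where
  "associate_value \<alpha> q i =
    (let a = (\<lambda>n. \<alpha> (list_encode (i # map q [0..<n])))
     in if \<exists>n. a n \<noteq> 0 then Some (a (LEAST n. a n \<noteq> 0) - 1) else None)"

definition associate :: "baire \<Rightarrow> (baire \<rightharpoonup> baire)" where
  "associate \<alpha> q =
    (if \<forall>i. associate_value \<alpha> q i \<noteq> None then Some (\<lambda>i. the (associate_value \<alpha> q i)) else None)"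

text \<open>
  A map between the underlying sets is an extensional function on \<open>points X\<close>. Its names are the
  associates of its realizers.
\<close>

definition function_space ::
  "'a represented_space \<Rightarrow> 'b represented_space \<Rightarrow> ('a \<Rightarrow> 'b) represented_space" where
  "function_space X Y \<alpha> =
    (if \<exists>f\<in>extensional (points X). realizes (associate \<alpha>) X Y f
     then Some (THE f. f \<in> extensional (points X) \<and> realizes (associate \<alpha>) X Y f) else None)"

lemma function_space_eq_Some_iff:
  "function_space X Y \<alpha> = Some f \<longleftrightarrow>
    f \<in> extensional (points X) \<and> realizes (associate \<alpha>) X Y f"
proof -
  have uniq: "g = h"
    if "g \<in> extensional (points X)" "realizes (associate \<alpha>) X Y g"
      "h \<in> extensional (points X)" "realizes (associate \<alpha>) X Y h" for g h
  proof (rule extensionalityI[OF that(1,3)])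
    fix x assume "x \<in> points X"
    then obtain q where "X q = Some x" by (auto simp: ran_def)
    then show "g x = h x" using that(2,4) unfolding realizes_def by force
  qed
  have "(THE g. g \<in> extensional (points X) \<and> realizes (associate \<alpha>) X Y g) = g"
    if "g \<in> extensional (points X)" "realizes (associate \<alpha>) X Y g" for g
    using that uniq by (intro the_equality) auto
  then show ?thesis
    unfolding function_space_def by auto
qed

section \<open>Open, compact and overt sets\<close>

definition opens :: "'a represented_space \<Rightarrow> 'a set represented_space" where
  "opens X =
    induced_space (function_space X sierpinski) (\<lambda>U. \<lambda>x\<in>points X. x \<in> U) (Pow (points X))"

definition closed_sets :: "'a represented_space \<Rightarrow> 'a set set" where
  "closed_sets X = {A. A \<subseteq> points X \<and> points X - A \<in> points (opens X)}"

definition overt :: "'a represented_space \<Rightarrow> 'a set represented_space" where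
  "overt X =
    induced_space (function_space (opens X) sierpinski)
      (\<lambda>A. \<lambda>U\<in>points (opens X). A \<inter> U \<noteq> {}) (closed_sets X)"

definition computable_open_sequence :: "'a represented_space \<Rightarrow> (nat \<Rightarrow> 'a set) \<Rightarrow> bool" where
  "computable_open_sequence X U \<longleftrightarrow> computable_map nat_space (opens X) U"

text \<open>
  A compact set \<open>K\<close> is represented by the map sending an open \<open>U\<close> to the truth value of \<open>K \<subseteq> U\<close>.
  This map determines only the saturation of \<open>K\<close>, so the compact sets do not form a
  \<open>represented_space\<close> unless one restricts to saturated ones. No such restriction is made: a
  computable sequence of compact sets is a sequence of arbitrary subsets for which the associated
  sequence of maps is computable (which includes that each of these maps is continuous, that is,
  that each of the sets is compact).
\<close>

definition computable_compact_sequence :: "'a represented_space \<Rightarrow> (nat \<Rightarrow> 'a set) \<Rightarrow> bool" where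
  "computable_compact_sequence X B \<longleftrightarrow>
    (\<forall>n. B n \<subseteq> points X) \<and>
    computable_map nat_space (function_space (opens X) sierpinski)
      (\<lambda>n. \<lambda>U\<in>points (opens X). B n \<subseteq> U)"

lemma opens_eq_Some_iff:
  "opens X \<alpha> = Some U \<longleftrightarrow>
    U \<subseteq> points X \<and> function_space X sierpinski \<alpha> = Some (\<lambda>x\<in>points X. x \<in> U)"
proof -
  have "inj_on (\<lambda>U. \<lambda>x\<in>points X. x \<in> U) (Pow (points X))"
  proof (rule inj_onI)
    fix U V assume U: "U \<in> Pow (points X)" and V: "V \<in> Pow (points X)"
      and eq: "(\<lambda>x\<in>points X. x \<in> U) = (\<lambda>x\<in>points X. x \<in> V)"
    have "x \<in> U \<longleftrightarrow> x \<in> V" if "x \<in> points X" for x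
      using fun_cong[OF eq, of x] that by simp
    with U V show "U = V" by blast
  qed
  then show ?thesis
    unfolding opens_def by (subst induced_space_eq_Some_iff) auto
qed

lemma overt_eq_Some_iff:
  "overt X \<alpha> = Some A \<longleftrightarrow>
    A \<in> closed_sets X \<and>
    function_space (opens X) sierpinski \<alpha> = Some (\<lambda>U\<in>points (opens X). A \<inter> U \<noteq> {})"
proof -
  have "inj_on (\<lambda>A. \<lambda>U\<in>points (opens X). A \<inter> U \<noteq> {}) (closed_sets X)"
  proof (rule inj_onI)
    fix A C assume A: "A \<in> closed_sets X" and C: "C \<in> closed_sets X"
      and eq: "(\<lambda>U\<in>points (opens X). A \<inter> U \<noteq> {}) = (\<lambda>U\<in>points (opens X). C \<inter> U \<noteq> {})"
    have meets: "A \<inter> U \<noteq> {} \<longleftrightarrow> C \<inter> U \<noteq> {}" if "U \<in> points (opens X)" for U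
      using fun_cong[OF eq, of U] that by simp
    have "A \<inter> (points X - C) = {}" "C \<inter> (points X - A) = {}"
      using A C meets[of "points X - A"] meets[of "points X - C"]
      unfolding closed_sets_def by auto
    then show "A = C"
      using A C unfolding closed_sets_def by auto
  qed
  then show ?thesis
    unfolding overt_def by (rule induced_space_eq_Some_iff)
qed

section \<open>Effective relatively compact systems\<close>

definition ercs ::
  "'a represented_space \<Rightarrow> (nat \<Rightarrow> 'a set) \<Rightarrow> (nat \<Rightarrow> 'a set) \<Rightarrow> (nat \<times> nat) set \<Rightarrow> bool" where
  "ercs X U B R \<longleftrightarrow>
    computable_open_sequence X U \<and>
    computable_compact_sequence X B \<and>
    ce 2 {[m, n] |m n. (m, n) \<in> R} \<and>
    (\<forall>(m, n)\<in>R. U m \<subseteq> B n) \<and>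
    (\<forall>V\<in>points (opens X). V = (\<Union>n\<in>{n. B n \<subseteq> V}. \<Union>m\<in>{m. (m, n) \<in> R}. U m))"

definition cantor :: "baire set" where
  "cantor = {p. \<forall>n. p n \<in> {0, 1}}"

text \<open>
  The finite family \<open>ns\<close> may be empty, so \<open>p n = 1\<close> is impossible when \<open>U n\<close> is related to an
  empty \<open>B k\<close>. Without this convention the constant sequence \<open>1\<close> would always be consistent, even
  though no set meets an empty \<open>U n\<close>.
\<close>

definition consistent ::
  "(nat \<Rightarrow> 'a set) \<Rightarrow> (nat \<Rightarrow> 'a set) \<Rightarrow> (nat \<times> nat) set \<Rightarrow> baire set" where
  "consistent U B R =
    {p \<in> cantor. \<forall>n k ns. p n = 1 \<longrightarrow> (n, k) \<in> R \<longrightarrow> B k \<subseteq> (\<Union>i\<in>set ns. U i) \<longrightarrow>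
      (\<exists>i\<in>set ns. p i = 1)}"

text \<open>Lightface: the complement is the union of a computably enumerable family of cylinders.\<close>

definition Pi01_cantor :: "baire set \<Rightarrow> bool" where
  "Pi01_cantor S \<longleftrightarrow>
    (\<exists>W. ce 1 {[list_encode w] |w. w \<in> W} \<and> S = {p \<in> cantor. \<forall>n. map p [0..<n] \<notin> W})"

definition baire_subspace :: "baire set \<Rightarrow> baire represented_space" where
  "baire_subspace S = induced_space Some id S"

end

theory Submission
  imports Defs
begin

text \<open>
  The set named by a consistent \<open>p\<close> is the complement \<open>A\<close> of the union of the \<open>U n\<close> with
  \<open>p n = 0\<close>. If \<open>V\<close> meets \<open>A\<close>, writing \<open>V\<close> as a union of basic sets gives \<open>p n = 1\<close>, \<open>(n, l) \<in> R\<close>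
  and \<open>B l \<subseteq> V\<close>. Conversely, if such \<open>n, l\<close> exist and \<open>V\<close> misses \<open>A\<close>, then \<open>B l\<close> is covered by the
  \<open>U i\<close> with \<open>p i = 0\<close>, hence by finitely many of them, which contradicts consistency.

  On the computational side, partial recursive functions are approximated in stages by total
  recursive ones, so that a computable enumeration of named sets yields a name of their union:
  at input length \<open>s\<close>, output \<open>1\<close> iff one of the first \<open>s\<close> names is seen to accept by stage \<open>s\<close>.
  Applied to finite unions of the \<open>U i\<close>, this makes \<open>B k \<subseteq> U i\<^sub>0 \<union> \<dots> \<union> U i\<^sub>l\<close> semidecidable and hence
  consistency co-semidecidable; applied to the maps \<open>V \<mapsto> B l \<subseteq> V\<close> with \<open>p n = 1\<close> and \<open>(n, l) \<in> R\<close>,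
  it gives the name of \<open>A\<close> as an overt set.
\<close>

section \<open>Total recursive functionals\<close>

text \<open>Agreement is demanded at length \<open>k\<close> only, since a program of
  \<open>partial_recursive\<close> carries no meaning on lists of another length. This leaves
  \<open>f\<close> free to be written as any convenient HOL term.\<close>

definition total_recursive :: "nat \<Rightarrow> (baire \<Rightarrow> nat list \<Rightarrow> nat) \<Rightarrow> bool" where
  "total_recursive k f \<longleftrightarrow>
    (\<exists>\<Phi>. partial_recursive k \<Phi> \<and> (\<forall>q xs. length xs = k \<longrightarrow> \<Phi> q xs = Some (f q xs)))"

lemma total_recursiveI:
  "partial_recursive k \<Phi> \<Longrightarrow> (\<And>q xs. length xs = k \<Longrightarrow> \<Phi> q xs = Some (f q xs)) \<Longrightarrow> total_recursive k f"
  unfolding total_recursive_def by blast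

lemma total_recursiveE:
  assumes "total_recursive k f"
  obtains \<Phi> where "partial_recursive k \<Phi>" "\<And>q xs. length xs = k \<Longrightarrow> \<Phi> q xs = Some (f q xs)"
  using assms unfolding total_recursive_def by blast

lemma total_recursive_cong:
  assumes "total_recursive k f" "\<And>q xs. length xs = k \<Longrightarrow> f q xs = g q xs"
  shows "total_recursive k g"
  using assms unfolding total_recursive_def by auto

lemma total_recursive_zero: "total_recursive k (\<lambda>q xs. 0)"
  by (rule total_recursiveI[OF partial_recursive.zero]) simp

lemma total_recursive_nth: "i < k \<Longrightarrow> total_recursive k (\<lambda>q xs. xs ! i)"
  by (rule total_recursiveI[OF partial_recursive.proj]) auto

lemma total_recursive_compose1:
  assumes "total_recursive 1 h" "total_recursive k f"
  shows "total_recursive k (\<lambda>q xs. h q [f q xs])"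
proof -
  from assms obtain H F where H: "partial_recursive 1 H" "\<And>q xs. length xs = 1 \<Longrightarrow> H q xs = Some (h q xs)"
    and F: "partial_recursive k F" "\<And>q xs. length xs = k \<Longrightarrow> F q xs = Some (f q xs)"
    by (elim total_recursiveE) blast
  show ?thesis
    by (rule total_recursiveI[OF partial_recursive.subst[of "[F]" H k]]) (use H F in auto)
qed

lemma total_recursive_compose2:
  assumes "total_recursive 2 h" "total_recursive k f" "total_recursive k g"
  shows "total_recursive k (\<lambda>q xs. h q [f q xs, g q xs])"
proof -
  from assms obtain H F G where H: "partial_recursive 2 H" "\<And>q xs. length xs = 2 \<Longrightarrow> H q xs = Some (h q xs)"
    and F: "partial_recursive k F" "\<And>q xs. length xs = k \<Longrightarrow> F q xs = Some (f q xs)"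
    and G: "partial_recursive k G" "\<And>q xs. length xs = k \<Longrightarrow> G q xs = Some (g q xs)"
    by (elim total_recursiveE) blast
  show ?thesis
    by (rule total_recursiveI[OF partial_recursive.subst[of "[F, G]" H k]])
      (use H F G in \<open>auto simp: numeral_2_eq_2\<close>)
qed

lemma total_recursive_rec_nat:
  assumes "total_recursive k b" "total_recursive (Suc (Suc k)) s"
  shows "total_recursive (Suc k) (\<lambda>q xs. rec_nat (b q (tl xs)) (\<lambda>i v. s q (i # v # tl xs)) (hd xs))"
proof -
  from assms obtain F G where F: "partial_recursive k F" "\<And>q xs. length xs = k \<Longrightarrow> F q xs = Some (b q xs)"
    and G: "partial_recursive (Suc (Suc k)) G"
      "\<And>q xs. length xs = Suc (Suc k) \<Longrightarrow> G q xs = Some (s q xs)"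
    by (elim total_recursiveE) blast
  have "rec_nat (F q (tl xs)) (\<lambda>i r. Option.bind r (\<lambda>v. G q (i # v # tl xs))) n
      = Some (rec_nat (b q (tl xs)) (\<lambda>i v. s q (i # v # tl xs)) n)"
    if "length xs = Suc k" for q xs n
    using that by (induction n) (auto simp: F G)
  then show ?thesis
    by (intro total_recursiveI[OF partial_recursive.prim_rec[OF F(1) G(1)]]) auto
qed

lemma total_recursive_oracle:
  assumes "total_recursive k f" shows "total_recursive k (\<lambda>q xs. q (f q xs))"
  using total_recursive_compose1[OF total_recursiveI[OF partial_recursive.query] assms, of "\<lambda>q xs. q (hd xs)"]
  by simp

lemma total_recursive_Suc:
  assumes "total_recursive k f" shows "total_recursive k (\<lambda>q xs. Suc (f q xs))"
  using total_recursive_compose1[OF total_recursiveI[OF partial_recursive.succ] assms, of "\<lambda>q xs. Suc (hd xs)"]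
  by simp

lemma total_recursive_const: "total_recursive k (\<lambda>q xs. n)"
  by (induction n) (auto intro: total_recursive_zero total_recursive_Suc)

text \<open>The schema recurses on the head of its argument list and passes the tail along.
  Recursion in one parameter, followed by substitution, allows an arbitrary counter \<open>n\<close>
  and parameter \<open>a\<close>.\<close>

lemma total_recursive_rec_nat_param:
  assumes b: "total_recursive 1 (\<lambda>q xs. b q (hd xs))"
    and s: "total_recursive 3 (\<lambda>q xs. s q (xs ! 2) (xs ! 0) (xs ! 1))"
    and "total_recursive k n" "total_recursive k a"
  shows "total_recursive k (\<lambda>q xs. rec_nat (b q (a q xs)) (s q (a q xs)) (n q xs))"
proof -
  have "total_recursive 2
      (\<lambda>q xs. rec_nat (b q (hd (tl xs))) (\<lambda>i v. s q ((i # v # tl xs) ! 2) i v) (hd xs))"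
    using total_recursive_rec_nat[of 1, OF b] s by (fastforce simp: numeral_2_eq_2 numeral_3_eq_3)
  then have "total_recursive 2 (\<lambda>q xs. rec_nat (b q (xs ! 1)) (s q (xs ! 1)) (xs ! 0))"
    by (rule total_recursive_cong) (auto simp: numeral_2_eq_2 length_Suc_conv)
  from total_recursive_compose2[OF this assms(3,4)] show ?thesis by simp
qed

lemma total_recursive_hd: "total_recursive 1 (\<lambda>q xs. hd xs)"
  by (rule total_recursive_cong[OF total_recursive_nth[of 0]]) (auto simp: length_Suc_conv)

section \<open>Arithmetic and case distinction\<close>

lemma total_recursive_add:
  assumes "total_recursive k f" "total_recursive k g"
  shows "total_recursive k (\<lambda>q xs. f q xs + g q xs)"
proof -
  have "rec_nat b (\<lambda>i v. Suc v) n = b + n" for b n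
    by (induction n) auto
  moreover have "total_recursive 3 (\<lambda>q xs. Suc (xs ! 1))"
    by (simp add: total_recursive_Suc total_recursive_nth)
  ultimately show ?thesis
    using total_recursive_rec_nat_param[where s = "\<lambda>q a i v. Suc v",
        OF total_recursive_hd _ assms(2,1)] by simp
qed

lemma total_recursive_pred:
  assumes "total_recursive k f"
  shows "total_recursive k (\<lambda>q xs. f q xs - 1)"
proof -
  have "rec_nat 0 (\<lambda>i v. i) n = n - 1" for n
    by (cases n) auto
  moreover have "total_recursive 3 (\<lambda>q xs. xs ! 0)"
    by (simp add: total_recursive_nth)
  ultimately show ?thesis
    using total_recursive_rec_nat_param[where s = "\<lambda>q a i v. i",
        OF total_recursive_zero _ assms assms] by simp
qed

lemma total_recursive_diff:
  assumes "total_recursive k f" "total_recursive k g"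
  shows "total_recursive k (\<lambda>q xs. f q xs - g q xs)"
proof -
  have "rec_nat b (\<lambda>i v. v - 1) n = b - n" for b n :: nat
    by (induction n) auto
  moreover have "total_recursive 3 (\<lambda>q xs. xs ! 1 - 1)"
    by (rule total_recursive_pred) (simp add: total_recursive_nth)
  ultimately show ?thesis
    using total_recursive_rec_nat_param[where s = "\<lambda>q a i v. v - 1",
        OF total_recursive_hd _ assms(2,1)] by simp
qed

lemma total_recursive_if0:
  assumes "total_recursive k c" "total_recursive k f" "total_recursive k g"
  shows "total_recursive k (\<lambda>q xs. if c q xs = 0 then f q xs else g q xs)"
proof -
  have *: "total_recursive k (\<lambda>q xs. if c q xs = 0 then 0 else f q xs)"
    if "total_recursive k c" "total_recursive k f" for c f
  proof -
    have "rec_nat 0 (\<lambda>i v. b) n = (if n = 0 then 0 else b)" for b n :: nat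
      by (cases n) auto
    moreover have "total_recursive 3 (\<lambda>q xs. xs ! 2)"
      by (simp add: total_recursive_nth)
    ultimately show ?thesis
      using total_recursive_rec_nat_param[where s = "\<lambda>q a i v. a",
          OF total_recursive_zero _ that] by simp
  qed
  \<comment> \<open>Truncated subtraction \<open>1 - c\<close> negates the test, so exactly one of
    the two summands is switched on.\<close>
  have "total_recursive k
      (\<lambda>q xs. (if 1 - c q xs = 0 then 0 else f q xs) + (if c q xs = 0 then 0 else g q xs))"
    by (intro total_recursive_add * total_recursive_diff total_recursive_const assms)
  then show ?thesis
    by (rule total_recursive_cong) auto
qed

lemma total_recursive_triangle:
  assumes "total_recursive k f"
  shows "total_recursive k (\<lambda>q xs. triangle (f q xs))"
proof -
  have "rec_nat 0 (\<lambda>i v. v + Suc i) n = triangle n" for n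
    by (induction n) auto
  moreover have "total_recursive 3 (\<lambda>q xs. xs ! 1 + Suc (xs ! 0))"
    by (intro total_recursive_add total_recursive_Suc total_recursive_nth) auto
  ultimately show ?thesis
    using total_recursive_rec_nat_param[where s = "\<lambda>q a i v. v + Suc i",
        OF total_recursive_zero _ assms assms] by simp
qed

section \<open>Inverting the Cantor pairing function\<close>

abbreviation pfst :: "nat \<Rightarrow> nat" where "pfst z \<equiv> fst (prod_decode z)"
abbreviation psnd :: "nat \<Rightarrow> nat" where "psnd z \<equiv> snd (prod_decode z)"

text \<open>The diagonal on which \<open>z\<close> lies in the Cantor enumeration, that is, the
  largest \<open>t\<close> with \<open>triangle t \<le> z\<close>.\<close>

definition triangle_root :: "nat \<Rightarrow> nat" where
  "triangle_root z = pfst z + psnd z"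

lemma triangle_root_add: "m \<le> t \<Longrightarrow> triangle_root (triangle t + m) = t"
  using prod_encode_inverse[of "(m, t - m)"] by (simp add: triangle_root_def prod_encode_def)

lemma prod_decode_triangle_root:
  "z = triangle (triangle_root z) + pfst z" "pfst z \<le> triangle_root z"
  using prod_decode_inverse[of z] by (auto simp: triangle_root_def prod_encode_def split: prod.splits)

text \<open>The successor of \<open>z\<close> stays on the same diagonal unless \<open>z\<close> is
  its last point. Written as a vanishing truncated difference, this test makes
  \<open>triangle_root\<close> primitive recursive, and both projections follow from it.\<close>

lemma triangle_root_Suc:
  "triangle_root (Suc z) =
    (if triangle (Suc (triangle_root z)) - Suc z = 0 then Suc (triangle_root z) else triangle_root z)"
proof -
  define t m where "t = triangle_root z" and "m = pfst z"
  have z: "z = triangle t + m" "m \<le> t"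
    using prod_decode_triangle_root[of z] by (auto simp: t_def m_def)
  show ?thesis
  proof (cases "m = t")
    case True
    then have "Suc z = triangle (Suc t) + 0" using z by simp
    then have "triangle_root (Suc z) = Suc t" using triangle_root_add[of 0 "Suc t"] by simp
    with True show ?thesis unfolding t_def[symmetric] using z by simp
  next
    case False
    then have "Suc z = triangle t + Suc m" "Suc m \<le> t" using z by auto
    then have "triangle_root (Suc z) = t" using triangle_root_add[of "Suc m" t] by metis
    with False show ?thesis unfolding t_def[symmetric] using z by simp
  qed
qed

lemma total_recursive_triangle_root:
  assumes "total_recursive k f"
  shows "total_recursive k (\<lambda>q xs. triangle_root (f q xs))"
proof -
  have "triangle_root 0 = 0"
    using triangle_root_add[of 0 0] by simp
  then have "rec_nat 0 (\<lambda>i v. if triangle (Suc v) - Suc i = 0 then Suc v else v) n = triangle_root n" for n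
    by (induction n) (simp_all add: triangle_root_Suc del: diff_is_0_eq triangle_Suc)
  moreover have "total_recursive 3
      (\<lambda>q xs. if triangle (Suc (xs ! 1)) - Suc (xs ! 0) = 0 then Suc (xs ! 1) else xs ! 1)"
    by (intro total_recursive_if0 total_recursive_diff total_recursive_triangle
        total_recursive_Suc total_recursive_nth) auto
  ultimately show ?thesis
    using total_recursive_rec_nat_param[where s = "\<lambda>q a i v. if triangle (Suc v) - Suc i = 0 then Suc v else v",
        OF total_recursive_zero _ assms assms] by presburger
qed

lemma total_recursive_pfst:
  assumes "total_recursive k f"
  shows "total_recursive k (\<lambda>q xs. pfst (f q xs))"
proof -
  have "pfst z = z - triangle (triangle_root z)" for z
    using prod_decode_triangle_root(1)[of z] by linarith
  then show ?thesis
    by (simp only:) (intro assms total_recursive_diff total_recursive_triangle total_recursive_triangle_root)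
qed

lemma total_recursive_psnd:
  assumes "total_recursive k f"
  shows "total_recursive k (\<lambda>q xs. psnd (f q xs))"
proof -
  have "psnd z = triangle_root z - pfst z" for z
    by (simp add: triangle_root_def)
  then show ?thesis
    by (simp only:) (intro assms total_recursive_diff total_recursive_pfst total_recursive_triangle_root)
qed

lemma total_recursive_prod_encode:
  assumes "total_recursive k f" "total_recursive k g"
  shows "total_recursive k (\<lambda>q xs. prod_encode (f q xs, g q xs))"
  unfolding prod_encode_def prod.case by (intro assms total_recursive_add total_recursive_triangle)

text \<open>
  From here on, all functionals take a single number. Bound variables, as in the step of a
  primitive recursion, are paired with that number, which thereby serves as an environment.
\<close>

definition recursive :: "(baire \<Rightarrow> nat \<Rightarrow> nat) \<Rightarrow> bool" where
  "recursive f \<longleftrightarrow> total_recursive 1 (\<lambda>q xs. f q (hd xs))"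

lemma recursive_cong:
  assumes "recursive f" "\<And>q x. f q x = g q x" shows "recursive g"
proof -
  have "f = g" using assms(2) by (intro ext)
  with assms(1) show ?thesis by simp
qed

lemma recursive_compose:
  assumes "recursive h" "recursive f"
  shows "recursive (\<lambda>q x. h q (f q x))"
  using total_recursive_compose1 assms unfolding recursive_def by fastforce

named_theorems recursive_intros

lemma recursive_id [recursive_intros]: "recursive (\<lambda>q x. x)"
  unfolding recursive_def by (rule total_recursive_hd)

lemma recursive_const [recursive_intros]: "recursive (\<lambda>q x. n)"
  unfolding recursive_def by (rule total_recursive_const)

lemma recursive_unary [recursive_intros]:
  assumes "recursive f"
  shows "recursive (\<lambda>q x. q (f q x))" "recursive (\<lambda>q x. Suc (f q x))"
    "recursive (\<lambda>q x. pfst (f q x))" "recursive (\<lambda>q x. psnd (f q x))"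
  using assms unfolding recursive_def
  by (rule total_recursive_oracle total_recursive_Suc total_recursive_pfst total_recursive_psnd)+

lemma recursive_binary [recursive_intros]:
  assumes "recursive f" "recursive g"
  shows "recursive (\<lambda>q x. f q x + g q x)" "recursive (\<lambda>q x. f q x - g q x)"
    "recursive (\<lambda>q x. prod_encode (f q x, g q x))"
  using assms unfolding recursive_def
  by (rule total_recursive_add total_recursive_diff total_recursive_prod_encode; assumption)+

lemma recursive_rec_nat [recursive_intros]:
  assumes "recursive b" "recursive n"
    and "recursive (\<lambda>q y. s q (pfst y) (pfst (psnd y)) (psnd (psnd y)))"
  shows "recursive (\<lambda>q x. rec_nat (b q x) (\<lambda>i v. s q x i v) (n q x))"
proof -
  have "total_recursive 3 (\<lambda>q xs. s q (xs ! 2) (xs ! 0) (xs ! 1))"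
    using total_recursive_compose1[OF assms(3)[unfolded recursive_def],
        of 3 "\<lambda>q xs. prod_encode (xs ! 2, prod_encode (xs ! 0, xs ! 1))"]
    by (force intro: total_recursive_prod_encode total_recursive_nth)
  with assms(1,2) show ?thesis
    unfolding recursive_def by (intro total_recursive_rec_nat_param total_recursive_hd)
qed

lemma recursive_compose2:
  assumes "recursive (\<lambda>q y. h q (pfst y) (psnd y))" "recursive f" "recursive g"
  shows "recursive (\<lambda>q x. h q (f q x) (g q x))"
  using recursive_compose[OF assms(1) recursive_binary(3)[OF assms(2,3)]] by simp

lemma recursive_compose3:
  assumes "recursive (\<lambda>q y. h q (pfst y) (pfst (psnd y)) (psnd (psnd y)))"
    and "recursive f" "recursive g" "recursive g'"
  shows "recursive (\<lambda>q x. h q (f q x) (g q x) (g' q x))"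
  using recursive_compose[OF assms(1) recursive_binary(3)[OF assms(2) recursive_binary(3)[OF assms(3,4)]]]
  by simp

section \<open>Decidable predicates and bounded search\<close>

definition decidable :: "(baire \<Rightarrow> nat \<Rightarrow> bool) \<Rightarrow> bool" where
  "decidable P \<longleftrightarrow> recursive (\<lambda>q x. of_bool (P q x))"

lemma decidable_cong:
  assumes "decidable P" "\<And>q x. P q x = Q q x" shows "decidable Q"
  using assms unfolding decidable_def by (elim recursive_cong) simp

lemma recursive_of_bool [recursive_intros]:
  "decidable P \<Longrightarrow> recursive (\<lambda>q x. of_bool (P q x))"
  unfolding decidable_def .

lemma recursive_if0:
  assumes "recursive c" "recursive f" "recursive g"
  shows "recursive (\<lambda>q x. if c q x = 0 then f q x else g q x)"
  using assms unfolding recursive_def by (rule total_recursive_if0)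

lemma recursive_if [recursive_intros]:
  assumes "decidable P" "recursive f" "recursive g"
  shows "recursive (\<lambda>q x. if P q x then f q x else g q x)"
  by (rule recursive_cong[OF recursive_if0[OF assms(1)[unfolded decidable_def] assms(3,2)]]) simp

lemma decidable_eq0: "recursive f \<Longrightarrow> decidable (\<lambda>q x. f q x = 0)"
  unfolding decidable_def of_bool_def by (intro recursive_if0 recursive_intros)

lemma decidable_compare [recursive_intros]:
  assumes "recursive f" "recursive g"
  shows "decidable (\<lambda>q x. f q x = g q x)" "decidable (\<lambda>q x. f q x \<le> g q x)"
    "decidable (\<lambda>q x. f q x < g q x)"
proof -
  have "decidable (\<lambda>q x. f q x - g q x = 0)" "decidable (\<lambda>q x. Suc (f q x) - g q x = 0)"
    "decidable (\<lambda>q x. (f q x - g q x) + (g q x - f q x) = 0)"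
    by (intro decidable_eq0 recursive_intros assms)+
  then show "decidable (\<lambda>q x. f q x = g q x)" "decidable (\<lambda>q x. f q x \<le> g q x)"
    "decidable (\<lambda>q x. f q x < g q x)"
    by (elim decidable_cong; auto)+
qed

lemma decidable_not [recursive_intros]:
  assumes "decidable P" shows "decidable (\<lambda>q x. \<not> P q x)"
  using decidable_eq0[OF assms[unfolded decidable_def]] by simp

lemma decidable_connectives [recursive_intros]:
  assumes "decidable P" "decidable Q"
  shows "decidable (\<lambda>q x. P q x \<and> Q q x)" "decidable (\<lambda>q x. P q x \<or> Q q x)"
    "decidable (\<lambda>q x. P q x \<longrightarrow> Q q x)"
proof -
  have "recursive (\<lambda>q x. if P q x then of_bool (Q q x) else 0)"
    "recursive (\<lambda>q x. if P q x then 1 else of_bool (Q q x))"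
    "recursive (\<lambda>q x. if P q x then of_bool (Q q x) else 1)"
    by (intro recursive_intros assms)+
  then show "decidable (\<lambda>q x. P q x \<and> Q q x)" "decidable (\<lambda>q x. P q x \<or> Q q x)"
    "decidable (\<lambda>q x. P q x \<longrightarrow> Q q x)"
    unfolding decidable_def by (elim recursive_cong; simp)+
qed

text \<open>The candidate \<open>r\<close> freezes once it satisfies \<open>P\<close> and otherwise
  advances by one. After \<open>b\<close> rounds it is the least witness below \<open>b\<close>, or
  \<open>b\<close> itself if there is none.\<close>

definition bounded_search :: "(nat \<Rightarrow> bool) \<Rightarrow> nat \<Rightarrow> nat" where
  "bounded_search P b = rec_nat 0 (\<lambda>_ r. if P r then r else Suc r) b"

lemma bounded_search_least: "j < bounded_search P b \<Longrightarrow> \<not> P j"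
  unfolding bounded_search_def
  by (induction b) (auto split: if_splits simp: less_Suc_eq)

lemma bounded_search_le: "bounded_search P b \<le> b"
  unfolding bounded_search_def by (induction b) (auto split: if_splits)

lemma bounded_search_found: "bounded_search P b < b \<Longrightarrow> P (bounded_search P b)"
  unfolding bounded_search_def by (induction b) (auto split: if_splits simp: less_Suc_eq)

lemma bounded_search_eq:
  assumes "P i" "\<And>j. j < i \<Longrightarrow> \<not> P j" "i \<le> b"
  shows "bounded_search P b = i"
  using bounded_search_least[of _ P b] bounded_search_le[of P b] bounded_search_found[of P b] assms
  by (metis less_le_trans linorder_neqE_nat)

lemma recursive_bounded_search [recursive_intros]:
  assumes "decidable (\<lambda>q y. P q (pfst y) (psnd y))" "recursive b"
  shows "recursive (\<lambda>q x. bounded_search (\<lambda>i. P q x i) (b q x))"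
proof -
  have "decidable (\<lambda>q x. P q (pfst x) (psnd (psnd x)))"
    using assms(1) unfolding decidable_def by (rule recursive_compose2) (intro recursive_intros)+
  then show ?thesis
    unfolding bounded_search_def by (intro recursive_intros assms)
qed

text \<open>The search ends strictly below its bound exactly when a witness exists; the universal
  quantifier is a failed search for a counterexample.\<close>

lemma decidable_bounded_quantifiers [recursive_intros]:
  assumes "decidable (\<lambda>q y. P q (pfst y) (psnd y))" "recursive b"
  shows "decidable (\<lambda>q x. \<exists>i<b q x. P q x i)" "decidable (\<lambda>q x. \<forall>i<b q x. P q x i)"
proof -
  have ex: "(\<exists>i<b. P i) \<longleftrightarrow> bounded_search P b < b" for P :: "nat \<Rightarrow> bool" and b
    using bounded_search_least[of _ P b] bounded_search_found[of P b]
    by (meson linorder_not_le order_less_le_trans)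
  have all: "(\<forall>i<b. P i) \<longleftrightarrow> \<not> (bounded_search (\<lambda>i. \<not> P i) b < b)" for P :: "nat \<Rightarrow> bool" and b
    using ex[of b "\<lambda>i. \<not> P i"] by blast
  show "decidable (\<lambda>q x. \<exists>i<b q x. P q x i)" "decidable (\<lambda>q x. \<forall>i<b q x. P q x i)"
    unfolding ex all by (intro recursive_intros assms)+
qed

section \<open>Codes of words\<close>

definition code_hd :: "nat \<Rightarrow> nat" where "code_hd c = pfst (c - 1)"
definition code_tl :: "nat \<Rightarrow> nat" where "code_tl c = psnd (c - 1)"
definition code_drop :: "nat \<Rightarrow> nat \<Rightarrow> nat" where "code_drop c i = rec_nat c (\<lambda>_. code_tl) i"
definition code_nth :: "nat \<Rightarrow> nat \<Rightarrow> nat" where "code_nth c i = code_hd (code_drop c i)"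
text \<open>The code serves as the search bound, because a word is never longer than its code.
  Dropping letters gives code 0 exactly when the word is exhausted.\<close>

definition code_length :: "nat \<Rightarrow> nat" where
  "code_length c = bounded_search (\<lambda>i. code_drop c i = 0) c"

lemma code_hd_list_encode [simp]: "code_hd (list_encode (x # xs)) = x"
  by (simp add: code_hd_def)

lemma pfst_0 [simp]: "pfst 0 = 0" and psnd_0 [simp]: "psnd 0 = 0"
  using prod_encode_inverse[of "(0, 0)"] by (simp_all add: prod_encode_def)

lemma code_tl_list_encode [simp]: "code_tl (list_encode xs) = list_encode (tl xs)"
  by (cases xs) (simp_all add: code_tl_def)

lemma code_drop_list_encode [simp]: "code_drop (list_encode xs) i = list_encode (drop i xs)"
  unfolding code_drop_def by (induction i) (simp_all add: drop_Suc tl_drop)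

lemma list_encode_eq_0 [simp]: "list_encode xs = 0 \<longleftrightarrow> xs = []"
  by (cases xs) auto

text \<open>Past the end the remaining code is 0, whose predecessor is again 0 and decodes to the
  pair \<open>(0, 0)\<close>; hence the default value 0.\<close>

lemma code_nth_list_encode:
  "code_nth (list_encode xs) i = (if i < length xs then xs ! i else 0)"
proof (cases "i < length xs")
  case True
  then show ?thesis by (simp add: code_nth_def Cons_nth_drop_Suc[symmetric] del: list_encode.simps)
next
  case False
  then show ?thesis by (simp add: code_nth_def code_hd_def)
qed

lemma length_le_list_encode: "length xs \<le> list_encode xs"
  by (induction xs) (auto intro: order_trans[OF _ le_prod_encode_2])

lemma code_length_list_encode [simp]: "code_length (list_encode xs) = length xs"
  unfolding code_length_def
  by (rule bounded_search_eq) (auto simp: length_le_list_encode)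

lemma set_list_decode: "set (list_decode c) = {code_nth c i |i. i < code_length c}"
proof -
  have "set xs = {code_nth (list_encode xs) i |i. i < code_length (list_encode xs)}" for xs
    by (auto simp: set_conv_nth code_nth_list_encode)
  from this[of "list_decode c"] show ?thesis by simp
qed

lemma recursive_code [recursive_intros]:
  assumes "recursive f"
  shows "recursive (\<lambda>q x. code_hd (f q x))" "recursive (\<lambda>q x. code_tl (f q x))"
  unfolding code_hd_def code_tl_def by (intro recursive_intros assms)+

lemma recursive_code_drop [recursive_intros]:
  assumes "recursive f" "recursive g"
  shows "recursive (\<lambda>q x. code_drop (f q x) (g q x))"
  unfolding code_drop_def by (intro recursive_intros assms)

lemma recursive_code_nth [recursive_intros]:
  assumes "recursive f" "recursive g"
  shows "recursive (\<lambda>q x. code_nth (f q x) (g q x))"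
  unfolding code_nth_def by (intro recursive_intros assms)

lemma recursive_code_length [recursive_intros]:
  assumes "recursive f"
  shows "recursive (\<lambda>q x. code_length (f q x))"
  unfolding code_length_def
  by (intro recursive_intros assms recursive_compose[OF assms])

lemma recursive_list_encode_Cons [recursive_intros]:
  assumes "recursive f" "recursive (\<lambda>q x. list_encode (g q x))"
  shows "recursive (\<lambda>q x. list_encode (f q x # g q x))"
  unfolding list_encode.simps by (intro recursive_intros assms)

lemma recursive_list_encode_map [recursive_intros]:
  assumes "recursive (\<lambda>q y. h q (pfst y) (psnd y))" "recursive n"
  shows "recursive (\<lambda>q x. list_encode (map (h q x) [0..<n q x]))"
proof -
  \<comment> \<open>Prefixing a letter is the only elementary operation on codes, so the word is
    built from its last letter backwards: after \<open>k\<close> rounds it covers the positions from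
    \<open>m - k\<close> on.\<close>
  have "rec_nat 0 (\<lambda>i v. Suc (prod_encode (g (m - Suc i), v))) k = list_encode (map g [m - k..<m])"
    if "k \<le> m" for g k m
    using that
  proof (induction k)
    case (Suc k)
    then have "[m - Suc k..<m] = (m - Suc k) # [m - k..<m]"
      by (subst upt_conv_Cons) (auto simp: Suc_diff_Suc)
    with Suc show ?case by simp
  qed simp
  from this[of m m for m]
  have *: "list_encode (map g [0..<m]) = rec_nat 0 (\<lambda>i v. Suc (prod_encode (g (m - Suc i), v))) m" for g m
    by simp
  have n: "recursive (\<lambda>q x. n q (f q x))" if "recursive f" for f
    by (rule recursive_compose[OF assms(2) that])
  show ?thesis
    unfolding * by (intro recursive_intros assms(2) recursive_compose2[OF assms(1)] n)
qed

section \<open>Approximation in stages\<close>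

text \<open>A stage value 0 means undecided, and \<open>Suc v\<close> announces the result
  \<open>v\<close>. Announcements are never wrong. They need not be monotone in the stage, only
  eventually permanent, so finitely many of them can be combined at a late stage.\<close>

definition approximates :: "(nat \<Rightarrow> nat) \<Rightarrow> nat option \<Rightarrow> bool" where
  "approximates a r \<longleftrightarrow>
    (\<forall>s. a s \<noteq> 0 \<longrightarrow> r = Some (a s - 1)) \<and> (r \<noteq> None \<longrightarrow> (\<forall>\<^sub>F s in sequentially. a s \<noteq> 0))"

lemma approximates_Some: "approximates (\<lambda>s. Suc v) (Some v)"
  by (simp add: approximates_def)

lemma approximates_bind:
  assumes a: "approximates a r" and b: "\<And>v. r = Some v \<Longrightarrow> approximates (b v) (g v)"
  shows "approximates (\<lambda>s. if a s = 0 then 0 else b (a s - 1) s) (Option.bind r g)"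
proof (cases r)
  case None
  then show ?thesis using a by (auto simp: approximates_def)
next
  case (Some v)
  then have v: "a s - 1 = v" if "a s \<noteq> 0" for s
    using a that by (auto simp: approximates_def)
  have "\<forall>\<^sub>F s in sequentially. a s \<noteq> 0"
    using a Some by (auto simp: approximates_def)
  then have "\<forall>\<^sub>F s in sequentially. (if a s = 0 then 0 else b (a s - 1) s) \<noteq> 0" if "g v \<noteq> None"
    using b[OF Some] that v by (auto simp: approximates_def elim: eventually_elim2)
  then show ?thesis
    using b[OF Some] Some v by (auto simp: approximates_def)
qed

lemma approximates_map:
  assumes "approximates a r"
  shows "approximates (\<lambda>s. if a s = 0 then 0 else Suc (g (a s - 1))) (map_option g r)"
  using assms by (auto simp: approximates_def elim: eventually_mono)

text \<open>The search stops at the first \<open>i\<close> that is undecided (0) or announced as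
  zero (1), and only the latter yields an announcement; all smaller indices have then announced
  positive values. Conversely, the finitely many indices up to the minimum are all decided at late
  stages.\<close>

lemma approximates_minimize:
  assumes "\<And>i. approximates (\<lambda>s. a s i) (r i)"
  shows "approximates
    (\<lambda>s. if a s (bounded_search (\<lambda>i. a s i \<le> 1) s) = 1
      then Suc (bounded_search (\<lambda>i. a s i \<le> 1) s) else 0)
    (if \<exists>i. r i = Some 0 \<and> (\<forall>j<i. r j \<noteq> None) then Some (LEAST i. r i = Some 0) else None)"
    (is "approximates (\<lambda>s. if a s (?m s) = 1 then Suc (?m s) else 0) ?r")
proof -
  have sound: "r i = Some (a s i - 1)" if "a s i \<noteq> 0" for s i
    using assms[of i] that by (auto simp: approximates_def)
  let ?b = "\<lambda>s. if a s (?m s) = 1 then Suc (?m s) else 0"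
  have "?r = Some (?b s - 1)" if "?b s \<noteq> 0" for s
  proof -
    from that have found: "a s (?m s) = 1" by (rule contrapos_np) (rule if_not_P)
    have m: "r (?m s) = Some 0" using sound[of s "?m s"] found by simp
    have less: "\<exists>v. r j = Some (Suc v)" if "j < ?m s" for j
      using bounded_search_least[OF that] sound[of s j] by (intro exI[of _ "a s j - 2"]) simp
    have "(LEAST i. r i = Some 0) = ?m s"
      using m by (rule Least_equality) (metis less leI nat.distinct(1) option.inject)
    moreover have "\<forall>j<?m s. r j \<noteq> None" using less by fastforce
    ultimately have "?r = Some (?m s)" using m by auto
    then show ?thesis by (simp only: found if_True diff_Suc_1 simp_thms)
  qed
  moreover have "\<forall>\<^sub>F s in sequentially. ?b s \<noteq> 0"
    if "?r \<noteq> None"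
  proof -
    have ex: "\<exists>i. r i = Some 0 \<and> (\<forall>j<i. r j \<noteq> None)"
      using that by (rule contrapos_np) (rule if_not_P)
    obtain i where i: "r i = Some 0" "\<forall>j<i. r j \<noteq> None" "\<forall>j<i. r j \<noteq> Some 0"
    proof -
      \<comment> \<open>Minimality for the whole condition also rules out earlier zeros, since
        everything below such a zero would be defined as well.\<close>
      define i where "i = (LEAST i. r i = Some 0 \<and> (\<forall>j<i. r j \<noteq> None))"
      have "r i = Some 0 \<and> (\<forall>j<i. r j \<noteq> None)"
        unfolding i_def using ex by (rule LeastI_ex)
      moreover from this have "r j \<noteq> Some 0" if j: "j < i" for j
        using not_less_Least[of j "\<lambda>i. r i = Some 0 \<and> (\<forall>j<i. r j \<noteq> None)"] j
        unfolding i_def[symmetric] by auto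
      ultimately show thesis by (intro that[of i]) auto
    qed
    have "\<forall>\<^sub>F s in sequentially. \<forall>j\<in>{..i}. a s j \<noteq> 0"
      using assms i by (intro eventually_ball_finite) (auto simp: approximates_def le_less)
    with eventually_ge_at_top[of i] show ?thesis
    proof eventually_elim
      case (elim s)
      then have "a s i = 1" using sound[of s i] i by force
      moreover have "\<not> a s j \<le> 1" if "j < i" for j
        using sound[of s j] elim i that by (force simp: le_Suc_eq)
      ultimately have "?m s = i" using elim by (intro bounded_search_eq) auto
      with \<open>a s i = 1\<close> show ?case by (simp only: if_True simp_thms nat.distinct)
    qed
  qed
  ultimately show ?thesis
    unfolding approximates_def by (intro conjI allI impI)
qed

text \<open>The arguments are the value of the constant oracle, which is later the index in a
  sequence, then the stage, then the input or its code.\<close>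

definition stage_recursive :: "(nat \<Rightarrow> nat \<Rightarrow> nat \<Rightarrow> nat) \<Rightarrow> bool" where
  "stage_recursive a \<longleftrightarrow> recursive (\<lambda>q y. a (pfst y) (pfst (psnd y)) (psnd (psnd y)))"

lemma stage_recursiveD:
  assumes "stage_recursive a" "recursive f" "recursive g" "recursive h"
  shows "recursive (\<lambda>q x. a (f q x) (g q x) (h q x))"
  using recursive_compose3[of "\<lambda>q. a"] assms unfolding stage_recursive_def by blast

lemma approximates_rec_nat:
  assumes "approximates a r" "\<And>i v. approximates (b i v) (g i v)"
  shows "approximates (\<lambda>s. rec_nat (a s) (\<lambda>i v. if v = 0 then 0 else b i (v - 1) s) n)
    (rec_nat r (\<lambda>i r. Option.bind r (g i)) n)"
  by (induction n) (auto intro: approximates_bind[of _ _ "b n" for n] assms)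

text \<open>
  Only constant oracles occur, as names of natural numbers, so that the oracle can become an
  argument of the approximating function.
\<close>

lemma partial_recursive_approximation:
  assumes "partial_recursive k \<Phi>"
  shows "\<exists>a. stage_recursive a \<and>
    (\<forall>n xs. length xs = k \<longrightarrow> approximates (\<lambda>s. a n s (list_encode xs)) (\<Phi> (\<lambda>_. n) xs))"
  using assms
proof induction
  case (zero k)
  then show ?case
    by (intro exI[of _ "\<lambda>n s c. Suc 0"])
      (auto simp: stage_recursive_def approximates_Some intro: recursive_intros)
next
  case succ
  have "stage_recursive (\<lambda>n s c. Suc (Suc (code_hd c)))"
    unfolding stage_recursive_def by (intro recursive_intros)
  then show ?case
    by (intro exI[of _ "\<lambda>n s c. Suc (Suc (code_hd c))"])
      (auto simp: approximates_Some length_Suc_conv simp del: list_encode.simps)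
next
  case (proj i k)
  have "stage_recursive (\<lambda>n s c. Suc (code_nth c i))"
    unfolding stage_recursive_def by (intro recursive_intros)
  with proj show ?case
    by (intro exI[of _ "\<lambda>n s c. Suc (code_nth c i)"])
      (auto simp: approximates_Some code_nth_list_encode)
next
  case query
  have "stage_recursive (\<lambda>n s c. Suc n)"
    unfolding stage_recursive_def by (intro recursive_intros)
  then show ?case
    by (intro exI[of _ "\<lambda>n s c. Suc n"]) (auto simp: approximates_Some)
next
  case (subst \<Gamma>s \<Phi> k)
  from subst.IH(1) obtain h where h: "stage_recursive h"
    "\<And>n xs. length xs = length \<Gamma>s \<Longrightarrow> approximates (\<lambda>s. h n s (list_encode xs)) (\<Phi> (\<lambda>_. n) xs)"
    by blast
  \<comment> \<open>The inner functionals are evaluated jointly: induction on their list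
    approximates the code of the word of all their results.\<close>
  have "\<exists>a. stage_recursive a \<and> (\<forall>n xs. length xs = k \<longrightarrow>
      approximates (\<lambda>s. a n s (list_encode xs))
        (map_option list_encode (those (map (\<lambda>\<Gamma>. \<Gamma> (\<lambda>_. n) xs) \<Gamma>s))))"
    using subst.IH(2)
  proof (induction \<Gamma>s)
    case Nil
    then show ?case
      by (intro exI[of _ "\<lambda>n s c. Suc 0"])
        (auto simp: stage_recursive_def approximates_Some intro: recursive_intros)
  next
    case (Cons \<Gamma> \<Gamma>s)
    then obtain a b where a: "stage_recursive a"
      "\<And>n xs. length xs = k \<Longrightarrow> approximates (\<lambda>s. a n s (list_encode xs)) (\<Gamma> (\<lambda>_. n) xs)"
      and b: "stage_recursive b"
      "\<And>n xs. length xs = k \<Longrightarrow> approximates (\<lambda>s. b n s (list_encode xs))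
        (map_option list_encode (those (map (\<lambda>\<Gamma>. \<Gamma> (\<lambda>_. n) xs) \<Gamma>s)))"
      by auto
    let ?c = "\<lambda>n s c. if a n s c = 0 then 0
      else if b n s c = 0 then 0 else Suc (Suc (prod_encode (a n s c - 1, b n s c - 1)))"
    have "stage_recursive ?c"
      unfolding stage_recursive_def
      by (intro recursive_intros stage_recursiveD[OF a(1)] stage_recursiveD[OF b(1)])
    moreover have "approximates (\<lambda>s. ?c n s (list_encode xs))
        (map_option list_encode (those (map (\<lambda>\<Gamma>. \<Gamma> (\<lambda>_. n) xs) (\<Gamma> # \<Gamma>s))))"
      if xs: "length xs = k" for n xs
    proof -
      have "map_option list_encode (those (map (\<lambda>\<Gamma>. \<Gamma> (\<lambda>_. n) xs) (\<Gamma> # \<Gamma>s))) =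
        Option.bind (\<Gamma> (\<lambda>_. n) xs) (\<lambda>v. map_option (\<lambda>w. Suc (prod_encode (v, w)))
          (map_option list_encode (those (map (\<lambda>\<Gamma>. \<Gamma> (\<lambda>_. n) xs) \<Gamma>s))))"
        by (auto split: option.splits simp: option.map_comp o_def)
      moreover have "approximates
          (\<lambda>s. if b n s (list_encode xs) = 0 then 0
            else Suc (Suc (prod_encode (v, b n s (list_encode xs) - 1))))
          (map_option (\<lambda>w. Suc (prod_encode (v, w)))
            (map_option list_encode (those (map (\<lambda>\<Gamma>. \<Gamma> (\<lambda>_. n) xs) \<Gamma>s))))" for v
        by (rule approximates_map[OF b(2)[OF xs]])
      ultimately show ?thesis
        by (simp only:) (rule approximates_bind[OF a(2)[OF xs], where b = "\<lambda>v s.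
          if b n s (list_encode xs) = 0 then 0
          else Suc (Suc (prod_encode (v, b n s (list_encode xs) - 1)))"])
    qed
    ultimately show ?case by blast
  qed
  then obtain a where a: "stage_recursive a"
    "\<And>n xs. length xs = k \<Longrightarrow> approximates (\<lambda>s. a n s (list_encode xs))
      (map_option list_encode (those (map (\<lambda>\<Gamma>. \<Gamma> (\<lambda>_. n) xs) \<Gamma>s)))"
    by blast
  \<comment> \<open>The approximation \<open>h\<close> is guaranteed only on words of the right
    length, and \<open>those\<close> preserves lengths.\<close>
  have those_length: "length ys = length zs" if "those zs = Some ys" for zs :: "nat option list" and ys
    using that by (induction zs arbitrary: ys) (auto split: option.splits)
  let ?c = "\<lambda>n s c. if a n s c = 0 then 0 else h n s (a n s c - 1)"
  have "stage_recursive ?c"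
    unfolding stage_recursive_def
    by (intro recursive_intros stage_recursiveD[OF a(1)] stage_recursiveD[OF h(1)])
  moreover have "approximates (\<lambda>s. ?c n s (list_encode xs))
      (Option.bind (those (map (\<lambda>\<Gamma>. \<Gamma> (\<lambda>_. n) xs) \<Gamma>s)) (\<Phi> (\<lambda>_. n)))"
    if xs: "length xs = k" for n xs
  proof -
    let ?r = "those (map (\<lambda>\<Gamma>. \<Gamma> (\<lambda>_. n) xs) \<Gamma>s)"
    have "Option.bind ?r (\<Phi> (\<lambda>_. n))
        = Option.bind (map_option list_encode ?r) (\<lambda>c. \<Phi> (\<lambda>_. n) (list_decode c))"
      by (cases ?r) auto
    moreover have "approximates (\<lambda>s. h n s c) (\<Phi> (\<lambda>_. n) (list_decode c))"
      if "map_option list_encode ?r = Some c" for c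
      using that h(2)[of "list_decode c"] those_length[of "map (\<lambda>\<Gamma>. \<Gamma> (\<lambda>_. n) xs) \<Gamma>s"] by auto
    ultimately show ?thesis
      using approximates_bind[OF a(2)[OF xs], of n "\<lambda>v s. h n s v"] by simp
  qed
  ultimately show ?case by blast
next
  case (prim_rec k \<Phi> \<Psi>)
  then obtain a b where a: "stage_recursive a"
    "\<And>n xs. length xs = k \<Longrightarrow> approximates (\<lambda>s. a n s (list_encode xs)) (\<Phi> (\<lambda>_. n) xs)"
    and b: "stage_recursive b"
    "\<And>n xs. length xs = Suc (Suc k) \<Longrightarrow> approximates (\<lambda>s. b n s (list_encode xs)) (\<Psi> (\<lambda>_. n) xs)"
    by blast
  \<comment> \<open>The nested pairing is the code of \<open>i # v # tl xs\<close>; the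
    \<open>v - 1\<close> in it strips the offset of an announcement.\<close>
  let ?c = "\<lambda>n s c. rec_nat (a n s (code_tl c))
    (\<lambda>i v. if v = 0 then 0 else b n s (Suc (prod_encode (i, Suc (prod_encode (v - 1, code_tl c)))))) (code_hd c)"
  have "stage_recursive ?c"
    unfolding stage_recursive_def
    by (intro recursive_intros stage_recursiveD[OF a(1)] stage_recursiveD[OF b(1)])
  moreover have "approximates (\<lambda>s. ?c n s (list_encode xs))
      (rec_nat (\<Phi> (\<lambda>_. n) (tl xs)) (\<lambda>i r. Option.bind r (\<lambda>v. \<Psi> (\<lambda>_. n) (i # v # tl xs))) (hd xs))"
    if xs: "length xs = Suc k" for n xs
  proof -
    have "code_hd (list_encode xs) = hd xs"
      using xs by (cases xs) (auto simp del: list_encode.simps)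
    then show ?thesis
      using approximates_rec_nat[of "\<lambda>s. a n s (list_encode (tl xs))" "\<Phi> (\<lambda>_. n) (tl xs)"
          "\<lambda>i v s. b n s (list_encode (i # v # tl xs))" "\<lambda>i v. \<Psi> (\<lambda>_. n) (i # v # tl xs)" "hd xs"]
        a(2)[of "tl xs"] b(2)[of "i # v # tl xs" for i v] xs by (simp cong: if_cong)
  qed
  ultimately show ?case by blast
next
  case (minimize k \<Phi>)
  then obtain a where a: "stage_recursive a"
    "\<And>n xs. length xs = Suc k \<Longrightarrow> approximates (\<lambda>s. a n s (list_encode xs)) (\<Phi> (\<lambda>_. n) xs)"
    by blast
  let ?m = "\<lambda>n s c. bounded_search (\<lambda>i. a n s (Suc (prod_encode (i, c))) \<le> 1) s"
  let ?c = "\<lambda>n s c. if a n s (Suc (prod_encode (?m n s c, c))) = 1 then Suc (?m n s c) else 0"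
  have "stage_recursive ?c"
    unfolding stage_recursive_def
    by (intro recursive_intros stage_recursiveD[OF a(1)])
  moreover have "approximates (\<lambda>s. ?c n s (list_encode xs))
      (if \<exists>i. \<Phi> (\<lambda>_. n) (i # xs) = Some 0 \<and> (\<forall>j<i. \<Phi> (\<lambda>_. n) (j # xs) \<noteq> None)
       then Some (LEAST i. \<Phi> (\<lambda>_. n) (i # xs) = Some 0) else None)"
    if xs: "length xs = k" for n xs
    using approximates_minimize[of "\<lambda>s i. a n s (list_encode (i # xs))" "\<lambda>i. \<Phi> (\<lambda>_. n) (i # xs)"]
      a(2)[of "i # xs" for i] xs by (simp cong: if_cong split del: if_split)
  ultimately show ?case by blast
qed

section \<open>Computable maps and enumerable sets by stages\<close>

lemma computable_recursive:
  assumes "recursive f"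
  shows "computable (\<lambda>q. Some (f q))"
  using assms unfolding recursive_def computable_def
  by (elim total_recursiveE) (fastforce intro: exI)

text \<open>Minimization over \<open>t\<close> of a total test that is 0 exactly when
  \<open>P t x\<close> holds halts iff a witness exists.\<close>

lemma ce_exists_decidable:
  assumes "decidable (\<lambda>q y. P (pfst y) (psnd y))"
  shows "ce 1 {[x] |x. \<exists>t. P t x}"
proof -
  have "recursive (\<lambda>q x. if P (pfst x) (psnd x) then 0 else 1)"
    by (intro recursive_intros assms)
  then have "total_recursive 2 (\<lambda>q xs. if P (xs ! 0) (xs ! 1) then 0 else 1)"
    unfolding recursive_def
    using total_recursive_compose1 total_recursive_prod_encode[OF total_recursive_nth[of 0 2] total_recursive_nth[of 1 2]]
    by fastforce
  then obtain \<Phi> where \<Phi>: "partial_recursive 2 \<Phi>"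
    "\<And>q xs. length xs = 2 \<Longrightarrow> \<Phi> q xs = Some (if P (xs ! 0) (xs ! 1) then 0 else 1)"
    by (rule total_recursiveE) blast
  have "partial_recursive (Suc 1) \<Phi>"
    using \<Phi>(1) by (simp add: numeral_2_eq_2)
  from partial_recursive.minimize[OF this] show ?thesis
    unfolding ce_def by - (rule exI, erule conjI, auto simp: \<Phi>(2) length_Suc_conv split: if_splits)
qed

definition stage_decidable :: "(nat \<Rightarrow> nat \<Rightarrow> bool) \<Rightarrow> bool" where
  "stage_decidable P \<longleftrightarrow> decidable (\<lambda>q y. P (pfst y) (psnd y))"

lemma stage_decidableD:
  assumes "stage_decidable P" "recursive f" "recursive g"
  shows "decidable (\<lambda>q x. P (f q x) (g q x))"
  using recursive_compose2[of "\<lambda>q s x. of_bool (P s x)"] assms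
  unfolding stage_decidable_def decidable_def by blast

text \<open>A list is accepted at a stage when its computation has announced a result;
  \<open>approximates\<close> makes this sound and eventually permanent.\<close>

lemma ce_approximation:
  assumes "ce k A"
  obtains P where "stage_decidable P"
    and "\<And>s xs. length xs = k \<Longrightarrow> P s (list_encode xs) \<Longrightarrow> xs \<in> A"
    and "\<And>xs. xs \<in> A \<Longrightarrow> \<forall>\<^sub>F s in sequentially. P s (list_encode xs)"
proof -
  from assms obtain \<Phi> where \<Phi>: "partial_recursive k \<Phi>" "A = {xs. length xs = k \<and> \<Phi> (\<lambda>_. 0) xs \<noteq> None}"
    unfolding ce_def by blast
  from partial_recursive_approximation[OF \<Phi>(1)] obtain a where a: "stage_recursive a"
    "\<And>n xs. length xs = k \<Longrightarrow> approximates (\<lambda>s. a n s (list_encode xs)) (\<Phi> (\<lambda>_. n) xs)"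
    by blast
  show thesis
  proof (rule that[of "\<lambda>s c. a 0 s c \<noteq> 0"])
    show "stage_decidable (\<lambda>s c. a 0 s c \<noteq> 0)"
      unfolding stage_decidable_def by (intro recursive_intros stage_recursiveD[OF a(1)])
  qed (use a(2) in \<open>auto simp: \<Phi>(2) approximates_def\<close>)
qed

lemma ce_relation_approximation:
  assumes "ce 2 {[m, n] |m n. (m, n) \<in> R}"
  obtains \<rho> where "stage_decidable \<rho>"
    and "\<And>s m n. \<rho> s (list_encode [m, n]) \<Longrightarrow> (m, n) \<in> R"
    and "\<And>m n. (m, n) \<in> R \<Longrightarrow> \<forall>\<^sub>F s in sequentially. \<rho> s (list_encode [m, n])"
proof -
  obtain P where "stage_decidable P"
    and sound: "\<And>s xs. length xs = 2 \<Longrightarrow> P s (list_encode xs) \<Longrightarrow> xs \<in> {[m, n] |m n. (m, n) \<in> R}"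
    and complete: "\<And>xs. xs \<in> {[m, n] |m n. (m, n) \<in> R} \<Longrightarrow> \<forall>\<^sub>F s in sequentially. P s (list_encode xs)"
    by (rule ce_approximation[OF assms]) blast
  show thesis
  proof (rule that[of P])
    show "(m, n) \<in> R" if "P s (list_encode [m, n])" for s m n
      using sound[OF _ that] by simp
    show "\<forall>\<^sub>F s in sequentially. P s (list_encode [m, n])" if "(m, n) \<in> R" for m n
      by (rule complete) (use that in blast)
  qed fact
qed

text \<open>Only entry 0 of a name matters in \<open>nat_space\<close>, so the constant sequence
  \<open>e\<close> names \<open>e\<close>. With this constant oracle the stage approximation applies
  and yields the entries of one fixed name \<open>\<alpha> e\<close> of \<open>F e\<close>.\<close>

lemma computable_map_nat_space_approximation:
  assumes "computable_map nat_space Z F"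
  obtains a \<alpha> where "stage_recursive a" "\<And>e x. approximates (\<lambda>s. a e s x) (Some (\<alpha> e x))"
    "\<And>e. Z (\<alpha> e) = Some (F e)"
proof -
  from assms obtain G \<Phi> where G: "realizes G nat_space Z F" and \<Phi>: "partial_recursive 1 \<Phi>"
    "\<And>q r n. G q = Some r \<Longrightarrow> \<Phi> q [n] = Some (r n)"
    unfolding computable_map_def computable_def by blast
  have "\<exists>r. G (\<lambda>_. e) = Some r \<and> Z r = Some (F e)" for e
    using G[unfolded realizes_def nat_space_def, rule_format, of "\<lambda>_. e" e] by simp
  then obtain \<alpha> where \<alpha>: "\<And>e. G (\<lambda>_. e) = Some (\<alpha> e)" "\<And>e. Z (\<alpha> e) = Some (F e)"
    by metis
  from partial_recursive_approximation[OF \<Phi>(1)] obtain a where a: "stage_recursive a"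
    "\<And>n xs. length xs = 1 \<Longrightarrow> approximates (\<lambda>s. a n s (list_encode xs)) (\<Phi> (\<lambda>_. n) xs)"
    by blast
  show thesis
  proof (rule that[of "\<lambda>e s x. a e s (list_encode [x])" \<alpha>])
    show "stage_recursive (\<lambda>e s x. a e s (list_encode [x]))"
      unfolding stage_recursive_def by (intro recursive_intros stage_recursiveD[OF a(1)])
    show "approximates (\<lambda>s. a e s (list_encode [x])) (Some (\<alpha> e x))" for e x
      using a(2)[of "[x]" e] \<Phi>(2)[OF \<alpha>(1)] by simp
  qed (rule \<alpha>(2))
qed

section \<open>Names of maps into Sierpinski space\<close>

text \<open>Phrased through a single output value, so that it makes sense even where
  \<open>associate\<close> is undefined.\<close>

definition accepts :: "baire \<Rightarrow> baire \<Rightarrow> bool" where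
  "accepts \<alpha> h \<longleftrightarrow> (\<exists>j v. associate_value \<alpha> h j = Some (Suc v))"

lemma associate_accepts:
  assumes "associate \<alpha> h = Some r"
  shows "(\<exists>n. r n \<noteq> 0) \<longleftrightarrow> accepts \<alpha> h"
proof -
  from assms have "associate_value \<alpha> h j = Some (r j)" for j
    by (auto simp: associate_def split: if_splits)
  then show ?thesis
    by (auto simp: accepts_def not0_implies_Suc gr0_conv_Suc)
qed

lemma function_space_sierpinski_iff:
  "function_space Y sierpinski \<alpha> = Some (\<lambda>y\<in>points Y. P y) \<longleftrightarrow>
    (\<forall>h y. Y h = Some y \<longrightarrow> associate \<alpha> h \<noteq> None \<and> (accepts \<alpha> h \<longleftrightarrow> P y))"
proof -
  have "(\<exists>r. associate \<alpha> h = Some r \<and> sierpinski r = Some ((\<lambda>y\<in>points Y. P y) y)) \<longleftrightarrow>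
      associate \<alpha> h \<noteq> None \<and> (accepts \<alpha> h \<longleftrightarrow> P y)" if "Y h = Some y" for h y
    using that associate_accepts[of \<alpha> h] by (auto simp: sierpinski_def ranI)
  then show ?thesis
    unfolding function_space_eq_Some_iff realizes_def by auto
qed

lemma associate_value_eq_Some_iff:
  "associate_value \<alpha> h j = Some v \<longleftrightarrow>
    (\<exists>m. \<alpha> (list_encode (j # map h [0..<m])) = Suc v \<and>
      (\<forall>m'<m. \<alpha> (list_encode (j # map h [0..<m'])) = 0))" (is "_ \<longleftrightarrow> (\<exists>m. ?a m = Suc v \<and> _)")
proof
  assume *: "associate_value \<alpha> h j = Some v"
  then have ex: "\<exists>m. ?a m \<noteq> 0" and v: "?a (LEAST m. ?a m \<noteq> 0) - 1 = v"
    by (auto simp: associate_value_def Let_def split: if_splits)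
  show "\<exists>m. ?a m = Suc v \<and> (\<forall>m'<m. ?a m' = 0)"
    using LeastI_ex[OF ex] v not_less_Least[of _ "\<lambda>m. ?a m \<noteq> 0"]
    by (intro exI[of _ "LEAST m. ?a m \<noteq> 0"]) auto
next
  assume "\<exists>m. ?a m = Suc v \<and> (\<forall>m'<m. ?a m' = 0)"
  then obtain m where m: "?a m = Suc v" "\<forall>m'<m. ?a m' = 0" by blast
  then have "(LEAST m. ?a m \<noteq> 0) = m"
    by (intro Least_equality) (auto simp: not_less[symmetric] simp del: list_encode.simps)
  moreover have "\<exists>m. ?a m \<noteq> 0"
    using m(1) by (intro exI[of _ m]) simp
  ultimately show "associate_value \<alpha> h j = Some v"
    using m(1) by (simp add: associate_value_def Let_def del: list_encode.simps)
qed

text \<open>The word at which the associate first answers is a prefix of \<open>h\<close>, and it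
  fixes the preceding silence as well. Any \<open>h'\<close> sharing it gets the same
  answer.\<close>

lemma accepts_continuous:
  assumes "accepts \<alpha> h"
  shows "\<exists>m. \<forall>h'. (\<forall>i<m. h' i = h i) \<longrightarrow> accepts \<alpha> h'"
proof -
  from assms obtain j v m where m: "\<alpha> (list_encode (j # map h [0..<m])) = Suc (Suc v)"
    "\<forall>m'<m. \<alpha> (list_encode (j # map h [0..<m'])) = 0"
    unfolding accepts_def associate_value_eq_Some_iff by blast
  have "accepts \<alpha> h'" if "\<forall>i<m. h' i = h i" for h'
  proof -
    have "map h' [0..<m'] = map h [0..<m']" if "m' \<le> m" for m'
      using that \<open>\<forall>i<m. h' i = h i\<close> by auto
    with m show ?thesis
      unfolding accepts_def associate_value_eq_Some_iff by (metis le_refl less_imp_le)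
  qed
  then show ?thesis by blast
qed

text \<open>
  Here \<open>a\<close> is a stage of an approximation of an associate: \<open>1\<close> stands for the value \<open>0\<close> of the
  associate, that is, no output yet, and numbers above \<open>2\<close> stand for a nonzero output.
\<close>

definition detects :: "(nat \<Rightarrow> nat) \<Rightarrow> baire \<Rightarrow> nat \<Rightarrow> bool" where
  "detects a h s \<longleftrightarrow>
    (\<exists>j<s. \<exists>m<s. 2 < a (list_encode (j # map h [0..<m])) \<and>
      (\<forall>m'<m. a (list_encode (j # map h [0..<m'])) = 1))"

text \<open>Stage \<open>s\<close> reads only words shorter than \<open>s\<close>, so it can be run
  on the coded prefix of length \<open>s\<close> instead of \<open>h\<close>.\<close>

lemma detects_cong:
  assumes "\<And>i. i < s \<Longrightarrow> h i = h' i"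
  shows "detects a h s = detects a h' s"
proof -
  have "map h [0..<m] = map h' [0..<m]" if "m < s" for m
    using assms that by auto
  then show ?thesis
    unfolding detects_def by (simp del: list_encode.simps map_eq_conv cong: conj_cong)
qed

lemma detects_sound:
  assumes "\<And>x. approximates (\<lambda>s. a s x) (Some (\<alpha> x))" "detects (a s) h s"
  shows "accepts \<alpha> h"
proof -
  from assms(2) obtain j m where m: "2 < a s (list_encode (j # map h [0..<m]))"
    "\<forall>m'<m. a s (list_encode (j # map h [0..<m'])) = 1"
    unfolding detects_def by blast
  have "\<alpha> x = a s x - 1" if "a s x \<noteq> 0" for x
    using assms(1)[of x] that by (auto simp: approximates_def)
  \<comment> \<open>One predecessor undoes the stage encoding and a second one the associate
    encoding; the output is still positive, which leaves \<open>Suc\<close> of a third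
    predecessor.\<close>
  with m have "associate_value \<alpha> h j = Some (Suc (a s (list_encode (j # map h [0..<m])) - 3))"
    unfolding associate_value_eq_Some_iff
    by (intro exI[of _ m]) (auto simp del: list_encode.simps)
  then show ?thesis unfolding accepts_def by blast
qed

lemma detects_complete:
  assumes "\<And>x. approximates (\<lambda>s. a s x) (Some (\<alpha> x))" "accepts \<alpha> h"
  shows "\<forall>\<^sub>F s in sequentially. detects (a s) h s"
proof -
  have ev: "\<forall>\<^sub>F s in sequentially. a s x = Suc (\<alpha> x)" for x
    using assms(1)[of x] by (auto simp: approximates_def elim!: eventually_mono)
  from assms(2) obtain j v m where m: "\<alpha> (list_encode (j # map h [0..<m])) = Suc (Suc v)"
    "\<forall>m'<m. \<alpha> (list_encode (j # map h [0..<m'])) = 0"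
    unfolding accepts_def associate_value_eq_Some_iff by blast
  have "\<forall>\<^sub>F s in sequentially. \<forall>m'\<in>{..m}.
      a s (list_encode (j # map h [0..<m'])) = Suc (\<alpha> (list_encode (j # map h [0..<m'])))"
    by (intro eventually_ball_finite ballI ev) simp
  with eventually_gt_at_top[of j] eventually_gt_at_top[of m] show ?thesis
  proof eventually_elim
    case (elim s)
    then have "2 < a s (list_encode (j # map h [0..<m]))"
      "\<forall>m'<m. a s (list_encode (j # map h [0..<m'])) = 1"
      using m by (auto simp del: list_encode.simps)
    with elim show ?case unfolding detects_def by blast
  qed
qed

lemma decidable_detects [recursive_intros]:
  assumes a: "recursive (\<lambda>q y. a q (pfst y) (psnd y))" and h: "recursive (\<lambda>q y. h q (pfst y) (psnd y))"
    and s: "recursive s"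
  shows "decidable (\<lambda>q x. detects (a q x) (h q x) (s q x))"
  unfolding detects_def
  by (intro recursive_intros recursive_compose2[OF a] recursive_compose2[OF h] recursive_compose[OF s])

text \<open>
  A name for the union, over the \<open>e\<close> enumerated by \<open>E\<close>, of the sets whose names are
  approximated by \<open>a e\<close>. The \<open>j\<close>-th output is computed from exactly the first \<open>j\<close> entries of the
  input, which also serves as the bound on the search.
\<close>

definition union_name :: "(nat \<Rightarrow> nat \<Rightarrow> bool) \<Rightarrow> (nat \<Rightarrow> nat \<Rightarrow> nat \<Rightarrow> nat) \<Rightarrow> baire" where
  "union_name E a x =
    (if code_length (code_tl x) < code_hd x then 0
     else Suc (of_bool (\<exists>e<code_length (code_tl x). E (code_length (code_tl x)) e \<and>
       detects (a e (code_length (code_tl x))) (code_nth (code_tl x)) (code_length (code_tl x)))))"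

text \<open>The enumeration \<open>E\<close> may consult the oracle and the environment, so the
  union can depend on a sequence \<open>p\<close> or on the code of a finite list.\<close>

lemma recursive_union_name:
  assumes E: "decidable (\<lambda>q y. E q (pfst y) (pfst (psnd y)) (psnd (psnd y)))"
    and a: "stage_recursive a" and f: "recursive f"
  shows "recursive (\<lambda>q x. union_name (E q x) a (f q x))"
proof -
  have E: "decidable (\<lambda>q x. E q (f q x) (g q x) (g' q x))"
    if "recursive f" "recursive g" "recursive g'" for f g g'
    using E that unfolding decidable_def by (rule recursive_compose3)
  show ?thesis
    unfolding union_name_def
    by (intro recursive_intros E stage_recursiveD[OF a] recursive_compose[OF f] f)
qed

text \<open>For output \<open>j\<close> the name is silent on words shorter than \<open>j\<close>
  and answers at length \<open>j\<close>, with 0 or 1. The associate is therefore total on all of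
  Baire space, whether or not \<open>h\<close> is a name.\<close>

lemma associate_union_name:
  "associate (union_name E a) h = Some (\<lambda>j. of_bool (\<exists>e<j. E j e \<and> detects (a e j) h j))"
proof -
  have name: "union_name E a (list_encode (j # map h [0..<n])) =
      (if n < j then 0 else Suc (of_bool (\<exists>e<n. E n e \<and> detects (a e n) h n)))" for j n
  proof -
    have "detects b (code_nth (list_encode (map h [0..<n]))) n = detects b h n" for b
      by (rule detects_cong) (simp add: code_nth_list_encode)
    then show ?thesis
      by (simp add: union_name_def del: list_encode.simps)
  qed
  have "associate_value (union_name E a) h j = Some (of_bool (\<exists>e<j. E j e \<and> detects (a e j) h j))" for j
    unfolding associate_value_eq_Some_iff name by (intro exI[of _ j]) simp
  then show ?thesis by (simp add: associate_def)
qed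

text \<open>Dovetailing with one parameter: the stage bounds the index, the enumeration and the
  detection together. Since each of these conditions is eventually permanent, they hold at a common
  stage.\<close>

lemma function_space_union_name:
  assumes a: "\<And>e x. approximates (\<lambda>s. a e s x) (Some (\<alpha> e x))"
    and sound: "\<And>s e. E s e \<Longrightarrow> P e" and complete: "\<And>e. P e \<Longrightarrow> \<forall>\<^sub>F s in sequentially. E s e"
    and name: "\<And>e. P e \<Longrightarrow> function_space Y sierpinski (\<alpha> e) = Some (\<lambda>y\<in>points Y. Q e y)"
  shows "function_space Y sierpinski (union_name E a) = Some (\<lambda>y\<in>points Y. \<exists>e. P e \<and> Q e y)"
proof -
  have "accepts (union_name E a) h \<longleftrightarrow> (\<exists>e. P e \<and> accepts (\<alpha> e) h)" for h
  proof
    assume "accepts (union_name E a) h"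
    then obtain j e where "E j e" "detects (a e j) h j"
      using associate_accepts[OF associate_union_name, of E a h] by auto
    then show "\<exists>e. P e \<and> accepts (\<alpha> e) h"
      using sound detects_sound[of "a e" "\<alpha> e", OF a] by blast
  next
    assume "\<exists>e. P e \<and> accepts (\<alpha> e) h"
    then obtain e where e: "P e" "accepts (\<alpha> e) h" by blast
    have "\<forall>\<^sub>F s in sequentially. e < s \<and> E s e \<and> detects (a e s) h s"
      by (intro eventually_conj eventually_gt_at_top complete[OF e(1)] detects_complete[of "a e" "\<alpha> e", OF a e(2)])
    then obtain s where "e < s \<and> E s e \<and> detects (a e s) h s"
      using eventually_happens'[OF sequentially_bot] by blast
    then show "accepts (union_name E a) h"
      using associate_accepts[OF associate_union_name, of E a h] by auto
  qed
  with name show ?thesis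
    unfolding function_space_sierpinski_iff by (auto simp: associate_union_name)
qed

section \<open>Countable unions of open sets and compactness\<close>

lemma opens_union_name:
  assumes "\<And>e x. approximates (\<lambda>s. a e s x) (Some (\<alpha> e x))"
    and "\<And>s e. E s e \<Longrightarrow> P e" "\<And>e. P e \<Longrightarrow> \<forall>\<^sub>F s in sequentially. E s e"
    and "\<And>e. P e \<Longrightarrow> opens X (\<alpha> e) = Some (U e)"
  shows "opens X (union_name E a) = Some (\<Union>e\<in>{e. P e}. U e)"
proof -
  have "(\<Union>e\<in>{e. P e}. U e) \<subseteq> points X"
    using assms(4) unfolding opens_eq_Some_iff by blast
  then show ?thesis
    using function_space_union_name[of a \<alpha> E P X "\<lambda>e x. x \<in> U e"] assms
    by (simp add: opens_eq_Some_iff)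
qed

text \<open>No effectivity is involved: chosen names, taken as approximations that are correct at
  every stage, and an arbitrary \<open>P\<close> already give a name of the union.\<close>

lemma open_Union:
  fixes U :: "nat \<Rightarrow> 'a set"
  assumes "\<And>e. U e \<in> points (opens X)"
  shows "(\<Union>e\<in>{e. P e}. U e) \<in> points (opens X)"
proof -
  from assms obtain \<alpha> where "\<And>e. opens X (\<alpha> e) = Some (U e)"
    unfolding ran_def by (simp only: mem_Collect_eq) metis
  then have "opens X (union_name (\<lambda>s. P) (\<lambda>e s x. Suc (\<alpha> e x))) = Some (\<Union>e\<in>{e. P e}. U e)"
    by (intro opens_union_name[of _ \<alpha>]) (auto simp: approximates_Some)
  then show ?thesis unfolding ran_def by blast
qed

text \<open>
  A computation accepting \<open>\<Union>e. U e\<close> reads only finitely much of the name of this union, and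
  finitely much of that name depends on only finitely many of the \<open>U e\<close>.
\<close>

lemma finite_subcover:
  fixes U :: "nat \<Rightarrow> 'a set"
  assumes K: "function_space (opens X) sierpinski \<beta> = Some (\<lambda>V\<in>points (opens X). K \<subseteq> V)"
    and U: "\<And>e. U e \<in> points (opens X)" and cover: "K \<subseteq> (\<Union>e\<in>{e. P e}. U e)"
  shows "\<exists>N. K \<subseteq> (\<Union>e\<in>{e. P e \<and> e < N}. U e)"
proof -
  from U obtain \<alpha> where \<alpha>: "\<And>e. opens X (\<alpha> e) = Some (U e)"
    unfolding ran_def by (simp only: mem_Collect_eq) metis
  define name where "name P = union_name (\<lambda>s. P) (\<lambda>e s x. Suc (\<alpha> e x))" for P
  have name: "opens X (name P) = Some (\<Union>e\<in>{e. P e}. U e)" for P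
    unfolding name_def by (intro opens_union_name[of _ \<alpha>]) (auto simp: approximates_Some \<alpha>)
  have acc: "accepts \<beta> (name P) \<longleftrightarrow> K \<subseteq> (\<Union>e\<in>{e. P e}. U e)" for P
    using K name unfolding function_space_sierpinski_iff by blast
  obtain N where N: "\<And>h. (\<forall>i<N. h i = name P i) \<Longrightarrow> accepts \<beta> h"
    using accepts_continuous[of \<beta> "name P"] cover acc by blast
  \<comment> \<open>Entry \<open>x\<close> of the name consults only indices below the length of the
    coded word, hence below \<open>x\<close>. Cutting \<open>P\<close> off at \<open>N\<close> thus
    preserves the first \<open>N\<close> entries.\<close>
  have "code_length (code_tl x) \<le> x" for x
  proof -
    have "code_length (code_tl x) \<le> code_tl x"
      unfolding code_length_def by (rule bounded_search_le)
    also have "\<dots> \<le> x"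
      using le_prod_encode_2[of "psnd (x - 1)" "pfst (x - 1)"] by (simp add: code_tl_def)
    finally show ?thesis .
  qed
  then have "name (\<lambda>e. P e \<and> e < N) i = name P i" if "i < N" for i
    unfolding name_def union_name_def using that by (meson le_less_trans less_trans)
  then show ?thesis
    using N acc by blast
qed


section \<open>Consistent sequences\<close>

text \<open>A violation of consistency is witnessed by finite data: a stage, the indices
  \<open>n\<close> and \<open>k\<close>, the code of a finite family and a prefix of
  \<open>p\<close>. The enumerable set \<open>W\<close> consists of the prefixes admitting such a
  witness.\<close>

lemma Pi01_consistent:
  assumes U: "stage_recursive a" "\<And>e x. approximates (\<lambda>s. a e s x) (Some (\<alpha> e x))"
      "\<And>e. opens X (\<alpha> e) = Some (U e)"
    and B: "stage_recursive b" "\<And>e x. approximates (\<lambda>s. b e s x) (Some (\<beta> e x))"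
      "\<And>e. function_space (opens X) sierpinski (\<beta> e) = Some (\<lambda>V\<in>points (opens X). B e \<subseteq> V)"
    and R: "ce 2 {[m, n] |m n. (m, n) \<in> R}"
  shows "Pi01_cantor (consistent U B R)"
proof -
  from R obtain \<rho> where \<rho>: "stage_decidable \<rho>"
    "\<And>s m n. \<rho> s (list_encode [m, n]) \<Longrightarrow> (m, n) \<in> R"
    "\<And>m n. (m, n) \<in> R \<Longrightarrow> \<forall>\<^sub>F s in sequentially. \<rho> s (list_encode [m, n])"
    by (rule ce_relation_approximation) blast
  define name where "name c = union_name (\<lambda>s e. \<exists>i<code_length c. code_nth c i = e) a" for c
  have "opens X (name c) = Some (\<Union>e\<in>{e. \<exists>i<code_length c. code_nth c i = e}. U e)" for c
    unfolding name_def by (rule opens_union_name[of _ \<alpha>]) (auto simp: U)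
  moreover have "{e. \<exists>i<code_length c. code_nth c i = e} = set (list_decode c)" for c
    by (auto simp: set_list_decode)
  ultimately have name: "opens X (name c) = Some (\<Union>e\<in>set (list_decode c). U e)" for c
    by simp
  have accepts: "accepts (\<beta> k) (name c) \<longleftrightarrow> B k \<subseteq> (\<Union>e\<in>set (list_decode c). U e)" for k c
    using B(3) name unfolding function_space_sierpinski_iff by blast
  \<comment> \<open>\<open>code_nth x n = 1\<close> forces \<open>n\<close> to lie inside the prefix
    \<open>x\<close>, since positions beyond it read as 0. The negative test would succeed there, so
    it is paired with an explicit length check.\<close>
  define Q where "Q s n k c x \<longleftrightarrow> code_nth x n = 1 \<and> \<rho> s (list_encode [n, k]) \<and>
    detects (b k s) (name c) s \<and>
    (\<forall>i<code_length c. code_nth c i < code_length x \<and> code_nth x (code_nth c i) \<noteq> 1)" for s n k c x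
  have recursive_name: "recursive (\<lambda>q x. name (f q x) (g q x))" if "recursive f" "recursive g" for f g
    unfolding name_def by (intro recursive_union_name recursive_intros recursive_compose[OF that(1)] that U(1))
  \<comment> \<open>A single search variable codes the quadruple of \<open>s\<close>,
    \<open>n\<close>, \<open>k\<close> and \<open>c\<close>.\<close>
  have "decidable (\<lambda>q y. Q (pfst (pfst y)) (pfst (psnd (pfst y)))
      (pfst (psnd (psnd (pfst y)))) (psnd (psnd (psnd (pfst y)))) (psnd y))"
    unfolding Q_def
    by (intro recursive_intros recursive_name stage_decidableD[OF \<rho>(1)] stage_recursiveD[OF B(1)])
  from ce_exists_decidable[OF this[THEN decidable_cong]]
  have "ce 1 {[x] |x. \<exists>t. Q (pfst t) (pfst (psnd t)) (pfst (psnd (psnd t))) (psnd (psnd (psnd t))) x}"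
    by simp
  moreover have ex: "(\<exists>t. Q (pfst t) (pfst (psnd t)) (pfst (psnd (psnd t))) (psnd (psnd (psnd t))) x) \<longleftrightarrow>
      (\<exists>s n k c. Q s n k c x)" for x
  proof
    assume "\<exists>s n k c. Q s n k c x"
    then obtain s n k c where "Q s n k c x" by blast
    then show "\<exists>t. Q (pfst t) (pfst (psnd t)) (pfst (psnd (psnd t))) (psnd (psnd (psnd t))) x"
      by (intro exI[of _ "prod_encode (s, prod_encode (n, prod_encode (k, c)))"]) simp
  qed blast
  \<comment> \<open>Every number is the code of a word, so nothing is lost in passing from numbers
    to words.\<close>
  moreover have "{[x] |x. \<exists>s n k c. Q s n k c x}
      = {[list_encode w] |w. w \<in> {w. \<exists>s n k c. Q s n k c (list_encode w)}}"
  proof (intro equalityI subsetI)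
    fix xs assume "xs \<in> {[x] |x. \<exists>s n k c. Q s n k c x}"
    then obtain x where x: "xs = [x]" "\<exists>s n k c. Q s n k c x" by blast
    then have "xs = [list_encode (list_decode x)] \<and> (\<exists>s n k c. Q s n k c (list_encode (list_decode x)))"
      by simp
    then show "xs \<in> {[list_encode w] |w. w \<in> {w. \<exists>s n k c. Q s n k c (list_encode w)}}"
      by blast
  qed blast
  ultimately have "ce 1 {[list_encode w] |w. w \<in> {w. \<exists>s n k c. Q s n k c (list_encode w)}}"
    by simp
  moreover have "consistent U B R =
    {p \<in> cantor. \<forall>l. map p [0..<l] \<notin> {w. \<exists>s n k c. Q s n k c (list_encode w)}}"
  proof (intro equalityI subsetI)
    fix p assume p: "p \<in> consistent U B R"
    have False if Q: "Q s n k c (list_encode (map p [0..<l]))" for l s n k c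
    proof -
      have "p n = 1"
        using Q by (auto simp: Q_def code_nth_list_encode split: if_splits)
      moreover have "(n, k) \<in> R" using Q \<rho>(2) by (auto simp: Q_def)
      moreover have "B k \<subseteq> (\<Union>e\<in>set (list_decode c). U e)"
        using Q detects_sound[of "b k" "\<beta> k", OF B(2)] unfolding Q_def accepts[symmetric] by blast
      ultimately obtain e where "e \<in> set (list_decode c)" "p e = 1"
        using p unfolding consistent_def by blast
      then show False
        using Q by (auto simp: Q_def set_list_decode code_nth_list_encode)
    qed
    with p show "p \<in> {p \<in> cantor. \<forall>l. map p [0..<l] \<notin> {w. \<exists>s n k c. Q s n k c (list_encode w)}}"
      by (auto simp: consistent_def)
  next
    fix p assume p: "p \<in> {p \<in> cantor. \<forall>l. map p [0..<l] \<notin> {w. \<exists>s n k c. Q s n k c (list_encode w)}}"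
    have "\<exists>i\<in>set ns. p i = 1"
      if "p n = 1" "(n, k) \<in> R" "B k \<subseteq> (\<Union>i\<in>set ns. U i)" for n k ns
    proof (rule ccontr)
      assume ns: "\<not> (\<exists>i\<in>set ns. p i = 1)"
      have "accepts (\<beta> k) (name (list_encode ns))"
        using that(3) by (simp add: accepts)
      then have "\<forall>\<^sub>F s in sequentially. \<rho> s (list_encode [n, k]) \<and>
          detects (b k s) (name (list_encode ns)) s"
        by (intro eventually_conj \<rho>(3) that(2) detects_complete[of "b k" "\<beta> k", OF B(2)])
      then obtain s where s: "\<rho> s (list_encode [n, k])" "detects (b k s) (name (list_encode ns)) s"
        using eventually_happens'[OF sequentially_bot] by blast
      \<comment> \<open>Long enough for the prefix of \<open>p\<close> to show the entry at
        \<open>n\<close> and all entries at \<open>ns\<close>.\<close>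
      define l where "l = Suc (Max (set (n # ns)))"
      have l: "i < l" if "i \<in> set (n # ns)" for i
        using that unfolding l_def by (intro le_imp_less_Suc Max_ge) auto
      have "Q s n k (list_encode ns) (list_encode (map p [0..<l]))"
        unfolding Q_def using s l ns that(1) by (auto simp: code_nth_list_encode simp del: list_encode.simps)
      with p show False by blast
    qed
    with p show "p \<in> consistent U B R"
      unfolding consistent_def by blast
  qed
  ultimately show ?thesis
    unfolding Pi01_cantor_def by blast
qed

section \<open>The overt set named by a consistent sequence\<close>

definition overt_of :: "'a represented_space \<Rightarrow> (nat \<Rightarrow> 'a set) \<Rightarrow> baire \<Rightarrow> 'a set" where
  "overt_of X U p = points X - (\<Union>n\<in>{n. p n = 0}. U n)"

lemma meets_overt_of_iff:
  assumes U: "\<And>n. U n \<in> points (opens X)"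
    and B: "\<And>k. function_space (opens X) sierpinski (\<beta> k) = Some (\<lambda>V\<in>points (opens X). B k \<subseteq> V)"
    and base: "\<And>V. V \<in> points (opens X) \<Longrightarrow> V = (\<Union>n\<in>{n. B n \<subseteq> V}. \<Union>m\<in>{m. (m, n) \<in> R}. U m)"
    and p: "p \<in> consistent U B R" and V: "V \<in> points (opens X)"
  shows "(\<exists>n l. p n = 1 \<and> (n, l) \<in> R \<and> B l \<subseteq> V) \<longleftrightarrow> overt_of X U p \<inter> V \<noteq> {}"
proof
  assume "\<exists>n l. p n = 1 \<and> (n, l) \<in> R \<and> B l \<subseteq> V"
  then obtain n l where nl: "p n = 1" "(n, l) \<in> R" "B l \<subseteq> V" by blast
  show "overt_of X U p \<inter> V \<noteq> {}"
  proof
    assume "overt_of X U p \<inter> V = {}"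
    moreover have "V \<subseteq> points X"
      using V by (auto simp: ran_def opens_eq_Some_iff)
    ultimately have "B l \<subseteq> (\<Union>n\<in>{n. p n = 0}. U n)"
      using nl(3) by (auto simp: overt_of_def)
    from finite_subcover[OF B U this] obtain N where "B l \<subseteq> (\<Union>n\<in>{n. p n = 0 \<and> n < N}. U n)"
      by blast
    \<comment> \<open>The finite subcover in the list form that \<open>consistent\<close> quantifies
      over; all its indices have \<open>p n = 0\<close>.\<close>
    then have "B l \<subseteq> (\<Union>n\<in>set (filter (\<lambda>n. p n = 0) [0..<N]). U n)"
      by (auto simp: conj_commute)
    with p nl(1,2) have "\<exists>n\<in>set (filter (\<lambda>n. p n = 0) [0..<N]). p n = 1"
      unfolding consistent_def by blast
    then show False by auto
  qed
next
  assume "overt_of X U p \<inter> V \<noteq> {}"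
  then obtain x where "x \<in> V" and x: "\<And>n. p n = 0 \<Longrightarrow> x \<notin> U n"
    by (auto simp: overt_of_def)
  with base[OF V] obtain n m where nm: "B n \<subseteq> V" "(m, n) \<in> R" "x \<in> U m"
    by blast
  \<comment> \<open>Membership in Cantor space turns \<open>p m \<noteq> 0\<close>, forced by
    \<open>x \<in> U m\<close>, into \<open>p m = 1\<close>.\<close>
  have "p m \<in> {0, 1}"
    using p by (simp add: consistent_def cantor_def)
  with x nm(3) have "p m = 1" by blast
  with nm show "\<exists>n l. p n = 1 \<and> (n, l) \<in> R \<and> B l \<subseteq> V" by blast
qed

lemma overt_of_closed:
  assumes "\<And>n. U n \<in> points (opens X)"
  shows "points X - overt_of X U p = (\<Union>n\<in>{n. p n = 0}. U n)"
    and "overt_of X U p \<in> closed_sets X"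
proof -
  have "U n \<subseteq> points X" for n
    using assms[of n] by (auto simp: ran_def opens_eq_Some_iff)
  then show *: "points X - overt_of X U p = (\<Union>n\<in>{n. p n = 0}. U n)"
    by (auto simp: overt_of_def)
  show "overt_of X U p \<in> closed_sets X"
    unfolding closed_sets_def
    using open_Union[of U X "\<lambda>n. p n = 0", OF assms] * by (auto simp: overt_of_def)
qed

text \<open>The realizer \<open>name\<close> is a total recursive functional of \<open>p\<close>;
  consistency enters only in showing that its output names \<open>overt_of X U p\<close>.\<close>

lemma computable_map_overt_of:
  assumes U: "\<And>n. U n \<in> points (opens X)"
    and B: "stage_recursive b" "\<And>e x. approximates (\<lambda>s. b e s x) (Some (\<beta> e x))"
      "\<And>k. function_space (opens X) sierpinski (\<beta> k) = Some (\<lambda>V\<in>points (opens X). B k \<subseteq> V)"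
    and R: "ce 2 {[m, n] |m n. (m, n) \<in> R}"
    and base: "\<And>V. V \<in> points (opens X) \<Longrightarrow> V = (\<Union>n\<in>{n. B n \<subseteq> V}. \<Union>m\<in>{m. (m, n) \<in> R}. U m)"
  shows "computable_map (baire_subspace (consistent U B R)) (overt X) (overt_of X U)"
proof -
  from R obtain \<rho> where \<rho>: "stage_decidable \<rho>"
    "\<And>s m n. \<rho> s (list_encode [m, n]) \<Longrightarrow> (m, n) \<in> R"
    "\<And>m n. (m, n) \<in> R \<Longrightarrow> \<forall>\<^sub>F s in sequentially. \<rho> s (list_encode [m, n])"
    by (rule ce_relation_approximation) blast
  \<comment> \<open>An index \<open>e\<close> codes a pair \<open>(n, l)\<close>: it is enumerated
    once \<open>p n = 1\<close> and \<open>(n, l) \<in> R\<close> are seen, and it contributes the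
    map \<open>V \<mapsto> B l \<subseteq> V\<close>.\<close>
  define name :: "baire \<Rightarrow> baire" where "name p = union_name
    (\<lambda>s e. p (pfst e) = 1 \<and> \<rho> s (list_encode [pfst e, psnd e])) (\<lambda>e. b (psnd e))" for p
  have "stage_recursive (\<lambda>e. b (psnd e))"
    unfolding stage_recursive_def by (intro recursive_intros stage_recursiveD[OF B(1)])
  then have "recursive name"
    unfolding name_def
    by (intro recursive_union_name recursive_intros stage_decidableD[OF \<rho>(1)])
  moreover have "overt X (name p) = Some (overt_of X U p)" if p: "p \<in> consistent U B R" for p
  proof -
    have "function_space (opens X) sierpinski (name p) =
      Some (\<lambda>V\<in>points (opens X). \<exists>e. (p (pfst e) = 1 \<and> (pfst e, psnd e) \<in> R) \<and> B (psnd e) \<subseteq> V)"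
      unfolding name_def
      by (rule function_space_union_name[of _ "\<lambda>e. \<beta> (psnd e)"])
        (use B(2,3) \<rho>(2,3) in \<open>auto simp del: list_encode.simps prod.collapse\<close>)
    moreover have "(\<exists>e. (p (pfst e) = 1 \<and> (pfst e, psnd e) \<in> R) \<and> B (psnd e) \<subseteq> V) \<longleftrightarrow>
        (\<exists>n l. p n = 1 \<and> (n, l) \<in> R \<and> B l \<subseteq> V)" for V
      by (metis fst_conv snd_conv prod_encode_inverse)
    ultimately show ?thesis
      using meets_overt_of_iff[OF U B(3) base p] overt_of_closed[OF U]
      by (simp add: overt_eq_Some_iff cong: restrict_cong)
  qed
  moreover have "p' = p \<and> p \<in> S" if "baire_subspace S p' = Some p" for S p p'
    using that unfolding baire_subspace_def by (subst (asm) induced_space_eq_Some_iff) auto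
  ultimately show ?thesis
    unfolding computable_map_def realizes_def
    by (intro exI[of _ "\<lambda>q. Some (name q)"] conjI computable_recursive) auto
qed

theorem theorem24:
  fixes X :: "'a represented_space"
    and U B :: "nat \<Rightarrow> 'a set"
    and R :: "(nat \<times> nat) set"
  assumes "ercs X U B R"
  shows "(Pi01_cantor (consistent U B R))
     \<and>
     (\<forall>A p. A \<subseteq> points X \<longrightarrow> p \<in> cantor \<longrightarrow> (\<forall>n. p n = 1 \<longleftrightarrow> A \<inter> U n \<noteq> {}) \<longrightarrow>
           p \<in> consistent U B R)
     \<and>
     (\<exists>f. computable_map (baire_subspace (consistent U B R)) (overt X) f \<and>
           (\<forall>p\<in>consistent U B R. f p \<in> closed_sets X \<and>
              {V \<in> points (opens X). \<exists>n l. p n = 1 \<and> (n, l) \<in> R \<and> B l \<subseteq> V} =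
              {V \<in> points (opens X). V \<inter> f p \<noteq> {}}))
     \<and>
     (\<forall>p\<in>consistent U B R. \<forall>A\<in>closed_sets X.
           {V \<in> points (opens X). \<exists>n l. p n = 1 \<and> (n, l) \<in> R \<and> B l \<subseteq> V} =
           {V \<in> points (opens X). V \<inter> A \<noteq> {}} \<longrightarrow>
           points X - A = (\<Union>n\<in>{n. p n = 0}. U n))"
proof -
  from assms have "computable_map nat_space (opens X) U"
    and "computable_map nat_space (function_space (opens X) sierpinski)
      (\<lambda>n. \<lambda>V\<in>points (opens X). B n \<subseteq> V)"
    and R: "ce 2 {[m, n] |m n. (m, n) \<in> R}" and UB: "\<And>m n. (m, n) \<in> R \<Longrightarrow> U m \<subseteq> B n"
    and base: "\<And>V. V \<in> points (opens X) \<Longrightarrow> V = (\<Union>n\<in>{n. B n \<subseteq> V}. \<Union>m\<in>{m. (m, n) \<in> R}. U m)"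
    unfolding ercs_def computable_open_sequence_def computable_compact_sequence_def by blast+
  from this(1,2) obtain a \<alpha> b \<beta> where U: "stage_recursive a"
    "\<And>e x. approximates (\<lambda>s. a e s x) (Some (\<alpha> e x))" "\<And>e. opens X (\<alpha> e) = Some (U e)"
    and B: "stage_recursive b" "\<And>e x. approximates (\<lambda>s. b e s x) (Some (\<beta> e x))"
      "\<And>e. function_space (opens X) sierpinski (\<beta> e) = Some (\<lambda>V\<in>points (opens X). B e \<subseteq> V)"
    by (elim computable_map_nat_space_approximation) blast
  have U_open: "U n \<in> points (opens X)" for n
    using U(3)[of n] unfolding ran_def by blast
  have meets: "{V \<in> points (opens X). \<exists>n l. p n = 1 \<and> (n, l) \<in> R \<and> B l \<subseteq> V} =
      {V \<in> points (opens X). V \<inter> overt_of X U p \<noteq> {}}" if "p \<in> consistent U B R" for p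
    using meets_overt_of_iff[OF U_open B(3) base that] by (simp add: Int_commute cong: conj_cong)
  show ?thesis
  proof (intro conjI allI impI ballI)
    show "Pi01_cantor (consistent U B R)"
      by (rule Pi01_consistent[OF U B R])
  next
    fix A p assume p: "p \<in> cantor" "\<forall>n. p n = 1 \<longleftrightarrow> A \<inter> U n \<noteq> {}"
    have "\<exists>i\<in>set ns. p i = 1"
      if "p n = 1" "(n, k) \<in> R" "B k \<subseteq> (\<Union>i\<in>set ns. U i)" for n k ns
    proof -
      \<comment> \<open>As \<open>U n \<subseteq> B k\<close> for related \<open>n\<close> and
        \<open>k\<close>, this point lies in \<open>B k\<close> and hence in a member of the
        cover.\<close>
      obtain x where "x \<in> A" "x \<in> U n" using p(2) \<open>p n = 1\<close> by blast
      with UB that(2,3) obtain i where "i \<in> set ns" "x \<in> U i" by blast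
      with p(2) \<open>x \<in> A\<close> show ?thesis by blast
    qed
    with p(1) show "p \<in> consistent U B R" unfolding consistent_def by blast
  next
    show "\<exists>f. computable_map (baire_subspace (consistent U B R)) (overt X) f \<and>
        (\<forall>p\<in>consistent U B R. f p \<in> closed_sets X \<and>
          {V \<in> points (opens X). \<exists>n l. p n = 1 \<and> (n, l) \<in> R \<and> B l \<subseteq> V} =
          {V \<in> points (opens X). V \<inter> f p \<noteq> {}})"
      by (intro exI[of _ "overt_of X U"] conjI ballI meets overt_of_closed(2) U_open
          computable_map_overt_of[OF U_open B R base])
  next
    fix p A assume p: "p \<in> consistent U B R" and A: "A \<in> closed_sets X"
      and eq: "{V \<in> points (opens X). \<exists>n l. p n = 1 \<and> (n, l) \<in> R \<and> B l \<subseteq> V} =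
        {V \<in> points (opens X). V \<inter> A \<noteq> {}}"
    have iff: "V \<inter> overt_of X U p \<noteq> {} \<longleftrightarrow> V \<inter> A \<noteq> {}" if "V \<in> points (opens X)" for V
    proof -
      have "V \<in> {V \<in> points (opens X). V \<inter> overt_of X U p \<noteq> {}} \<longleftrightarrow>
          V \<in> {V \<in> points (opens X). V \<inter> A \<noteq> {}}"
        by (simp only: meets[OF p, symmetric] eq)
      with that show ?thesis by simp
    qed
    \<comment> \<open>A closed set is determined by the open sets it meets: each of the two sets
      misses its own open complement, so by \<open>iff\<close> the other one misses it too.\<close>
    have "points X - A \<in> points (opens X)" "points X - overt_of X U p \<in> points (opens X)"
      using A overt_of_closed(2)[of U X p, OF U_open] by (simp_all add: closed_sets_def)
    from iff[OF this(1)] iff[OF this(2)]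
    have "(points X - overt_of X U p) \<inter> A = {}" "(points X - A) \<inter> overt_of X U p = {}"
      by blast+
    with A have "A = overt_of X U p"
      by (auto simp: closed_sets_def overt_of_def)
    then show "points X - A = (\<Union>n\<in>{n. p n = 0}. U n)"
      using overt_of_closed(1)[of U X p, OF U_open] by simp
  qed
qed

end
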